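(* Let $G$ be a graph without loops. If $I=I(G)$ is Cohen-Macaulay (i.e. $R/I(G)$ is a Cohen-Macaulay ring) and $e_1=\{x_1,y_1\},\dots,e_d=\{x_d,y_d\}$ is a perfect matching of $G$ consisting of distinct regular edges such that for each $2\le i\le d$ either $N_G(x_i)\cap\{x_1,y_1,\dots,x_{i-1},y_{i-1}\}=\emptyset$ or $N_G(y_i)\cap\{x_1,y_1,\dots,x_{i-1},y_{i-1}\}=\emptyset$, then the $h$-vector of $I$ is the $f$-vector of the simplicial complex corresponding to the induced graph on $\{x_1,\dots,x_d\}$ in the whiskered graph $G^{e_1,\dots,e_d}$.
   Context: All graphs are finite. For a field $k$, $R$ is the polynomial ring over $k$ with variables the vertices of $G$, and the edge ideal is $I(G)=\langle uv \mid \{u,v\}\in E(G)\rangle\subseteq R$. The neighbor set is $N_G(v)=\{u\mid \{u,v\}\in E(G)\}$. A matching is a set of pairwise disjoint edges; it is perfect if every vertex of $G$ lies in one of its edges. Regular edge: an edge $\{a,b\}$ of $G$ is regular if for every associated prime $Q$ of $R/I(G)$ one has $ab\notin Q^2$; that is, precisely one of $a,b$ is in $Q$. For an edge $e=\{x,y\}\in E(G)$ with $x\neq y$ (with the vertices labelled in this order), $G^e$ is the graph with $V(G^e)=V(G)$ and edges: (i) $\{a,b\}\in E(G^e)$ if $\{a,b\}\in E(G)$ and $a,b\neq y$; (ii) $\{a,x\}\in E(G^e)$ if $\{a,y\}\in E(G)$ and $a\neq x$; (iii) $\{x,y\}\in E(G^e)$. Iterates: $G^{e_1,e_2}=(G^{e_1})^{e_2}$,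 and similarly for longer lists. $h$-vector: writing $\sum_{s\ge0}\dim_k(R/I)_s t^s=\frac{h_0+h_1t+\cdots+h_{\delta}t^{\delta}}{(1-t)^{\delta}}$ with $\delta=\dim(R/I)$, the $h$-vector of $I$ is $(h_0,\dots,h_{\delta})$. The simplicial complex corresponding to a graph $H$ is its independence complex: its faces are the independent sets of vertices of $H$ (sets containing no edge). Its $f$-vector is $(f_{-1},f_0,f_1,\dots)$, where $f_{-1}=1$ and $f_i$ is the number of independent sets of $H$ with $i+1$ elements. The equality of the $h$-vector with the $f$-vector means $h_i=f_{i-1}$ for all $i\ge 0$ (entries beyond the end of a vector being $0$). *)

theory Defs
  imports
    "HOL-Algebra.Algebra"
    "HOL-Library.Poly_Mapping"
    "HOL-Library.Extended_Nat"
    "HOL-Computational_Algebra.Formal_Power_Series"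
begin

section \<open>Graphs\<close>

text \<open>
  A graph is given by its vertex set \<open>V\<close> and its set of edges \<open>E\<close>; a loop at \<open>v\<close> is the edge
  \<open>{v, v} = {v}\<close>.
\<close>

definition finite_graph :: "'v set \<Rightarrow> 'v set set \<Rightarrow> bool"
  where "finite_graph V E \<longleftrightarrow> finite V \<and> (\<forall>e\<in>E. \<exists>a\<in>V. \<exists>b\<in>V. e = {a, b})"

definition loopless :: "'v set set \<Rightarrow> bool"
  where "loopless E \<longleftrightarrow> (\<forall>v. {v} \<notin> E)"

definition neighbors :: "'v set set \<Rightarrow> 'v \<Rightarrow> 'v set"
  where "neighbors E v = {u. {u, v} \<in> E}"

definition perfect_matching :: "'v set \<Rightarrow> 'v set set \<Rightarrow> 'v set set \<Rightarrow> bool"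
  where "perfect_matching V E M \<longleftrightarrow> M \<subseteq> E \<and> pairwise disjnt M \<and> \<Union>M = V"

definition induced_edges :: "'v set set \<Rightarrow> 'v set \<Rightarrow> 'v set set"
  where "induced_edges E W = {e \<in> E. e \<subseteq> W}"

text \<open>
  The edges of \<open>G\<^sup>e\<close> for \<open>e = {x, y}\<close> with the endpoints in the order \<open>(x, y)\<close>: the neighbours of
  \<open>y\<close> other than \<open>x\<close> are reattached to \<open>x\<close>. The vertex set does not change.
\<close>

definition whisker_edges :: "'v set set \<Rightarrow> 'v \<times> 'v \<Rightarrow> 'v set set"
  where "whisker_edges E = (\<lambda>(x, y).
    {{a, b} | a b. {a, b} \<in> E \<and> a \<noteq> y \<and> b \<noteq> y} \<union>
    {{a, x} | a. {a, y} \<in> E \<and> a \<noteq> x} \<union>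
    {{x, y}})"

definition whisker_edges_list :: "'v set set \<Rightarrow> ('v \<times> 'v) list \<Rightarrow> 'v set set"
  where "whisker_edges_list E es = foldl whisker_edges E es"

definition independence_complex :: "'v set \<Rightarrow> 'v set set \<Rightarrow> 'v set set"
  where "independence_complex V E = {F. F \<subseteq> V \<and> (\<forall>e\<in>E. \<not> e \<subseteq> F)}"

text \<open>
  The dimension of a face is its cardinality minus one, so the \<open>f\<close>-vector starts at index \<open>-1\<close>.
  For a finite complex all but finitely many entries are \<open>0\<close>.
\<close>

definition f_vector :: "'v set set \<Rightarrow> int \<Rightarrow> nat"
  where "f_vector \<Delta> i = card {F \<in> \<Delta>. int (card F) = i + 1}"


section \<open>Commutative algebra\<close>

text \<open>Chains \<open>c 0 \<subset> c 1 \<subset> \<dots> \<subset> c n\<close> of prime ideals; such a chain has length \<open>n\<close>.\<close>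

definition prime_chain :: "('a, 'b) ring_scheme \<Rightarrow> nat \<Rightarrow> (nat \<Rightarrow> 'a set) \<Rightarrow> bool"
  where "prime_chain A n c \<longleftrightarrow>
    (\<forall>i\<le>n. primeideal (c i) A) \<and> (\<forall>i<n. c i \<subset> c (Suc i))"

text \<open>For the zero ring the supremum is over the empty set, and the value is \<open>0\<close>.\<close>

definition krull_dim :: "('a, 'b) ring_scheme \<Rightarrow> enat"
  where "krull_dim A = Sup {enat n | n. \<exists>c. prime_chain A n c}"

definition height :: "('a, 'b) ring_scheme \<Rightarrow> 'a set \<Rightarrow> enat"
  where "height A P = Sup {enat n | n. \<exists>c. prime_chain A n c \<and> c n = P}"

text \<open>
  \<open>as ! i\<close> is a nonzerodivisor on \<open>A\<close> modulo the ideal generated by the preceding elements, and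
  the elements together do not generate the unit ideal.
\<close>

definition regular_sequence :: "('a, 'b) ring_scheme \<Rightarrow> 'a list \<Rightarrow> bool"
  where "regular_sequence A as \<longleftrightarrow>
    set as \<subseteq> carrier A \<and>
    (\<forall>i<length as. \<forall>b\<in>carrier A.
       as ! i \<otimes>\<^bsub>A\<^esub> b \<in> Idl\<^bsub>A\<^esub> (set (take i as)) \<longrightarrow> b \<in> Idl\<^bsub>A\<^esub> (set (take i as))) \<and>
    Idl\<^bsub>A\<^esub> (set as) \<noteq> carrier A"

definition depth_ideal :: "('a, 'b) ring_scheme \<Rightarrow> 'a set \<Rightarrow> enat"
  where "depth_ideal A J = Sup {enat (length as) | as. regular_sequence A as \<and> set as \<subseteq> J}"

text \<open>
  This is the definition in Eisenbud, \<^emph>\<open>Commutative Algebra\<close>, Section 18.2. For a maximal ideal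
  \<open>P\<close> of a Noetherian ring, \<open>depth_ideal A P\<close> and \<open>height A P\<close> are the depth and the dimension of
  the localization at \<open>P\<close>.
\<close>

definition cohen_macaulay :: "('a, 'b) ring_scheme \<Rightarrow> bool"
  where "cohen_macaulay A \<longleftrightarrow>
    cring A \<and> noetherian_ring A \<and> (\<forall>P. maximalideal P A \<longrightarrow> depth_ideal A P = height A P)"

text \<open>The associated primes of \<open>A/I\<close> as an \<open>A\<close>-module: \<open>Q\<close> is the annihilator of the class of \<open>f\<close>.\<close>

definition associated_prime :: "('a, 'b) ring_scheme \<Rightarrow> 'a set \<Rightarrow> 'a set \<Rightarrow> bool"
  where "associated_prime A I Q \<longleftrightarrow>
    primeideal Q A \<and> (\<exists>f\<in>carrier A. Q = {r \<in> carrier A. r \<otimes>\<^bsub>A\<^esub> f \<in> I})"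


section \<open>Polynomial rings and edge ideals\<close>

text \<open>
  A monomial is an exponent vector \<open>'v \<Rightarrow>\<^sub>0 nat\<close>. The ring \<open>k[V]\<close> consists of the polynomials over
  the type \<open>'v\<close> in which only variables from \<open>V\<close> occur.
\<close>

type_synonym ('v, 'k) mpoly = "('v \<Rightarrow>\<^sub>0 nat) \<Rightarrow>\<^sub>0 'k"

definition poly_ring :: "'v set \<Rightarrow> ('v, 'k::field) mpoly ring"
  where "poly_ring V =
    \<lparr> carrier = {p. \<forall>m\<in>Poly_Mapping.keys p. Poly_Mapping.keys m \<subseteq> V},
      monoid.mult = (*), one = 1, ring.zero = 0, add = (+) \<rparr>"

definition var :: "'v \<Rightarrow> ('v, 'k::field) mpoly"
  where "var v = Poly_Mapping.single (Poly_Mapping.single v 1) 1"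

definition const :: "'k \<Rightarrow> ('v, 'k::field) mpoly"
  where "const c = Poly_Mapping.single 0 c"

definition edge_ideal :: "'v set \<Rightarrow> 'v set set \<Rightarrow> ('v, 'k::field) mpoly set"
  where "edge_ideal V E = Idl\<^bsub>poly_ring V\<^esub> {var u * var v | u v. {u, v} \<in> E}"

definition edge_ring :: "'v set \<Rightarrow> 'v set set \<Rightarrow> ('v, 'k::field) mpoly set ring"
  where "edge_ring V E = poly_ring V Quot edge_ideal V E"

text \<open>The argument of type \<open>'k itself\<close> names the coefficient field.\<close>

definition regular_edge :: "'k::field itself \<Rightarrow> 'v set \<Rightarrow> 'v set set \<Rightarrow> 'v \<Rightarrow> 'v \<Rightarrow> bool"
  where "regular_edge k V E a b \<longleftrightarrow>
    {a, b} \<in> E \<and>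
    (\<forall>Q :: ('v, 'k) mpoly set. associated_prime (poly_ring V) (edge_ideal V E) Q \<longrightarrow>
       var a * var b \<notin> Q \<cdot>\<^bsub>poly_ring V\<^esub> Q)"

text \<open>
  For an ideal \<open>I\<close> of \<open>k[V]\<close>: the copy of \<open>k\<close> in \<open>k[V]/I\<close>, and the image of the space of
  homogeneous polynomials of degree \<open>s\<close>. For homogeneous \<open>I\<close> the latter is \<open>(k[V]/I)\<^sub>s\<close>.
\<close>

definition quot_scalars :: "'v set \<Rightarrow> ('v, 'k::field) mpoly set \<Rightarrow> ('v, 'k) mpoly set set"
  where "quot_scalars V I = {I +>\<^bsub>poly_ring V\<^esub> const c | c. True}"

definition quot_graded_piece ::
    "'v set \<Rightarrow> ('v, 'k::field) mpoly set \<Rightarrow> nat \<Rightarrow> ('v, 'k) mpoly set set"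
  where "quot_graded_piece V I s =
    {I +>\<^bsub>poly_ring V\<^esub> p | p. p \<in> carrier (poly_ring V) \<and>
       (\<forall>m\<in>Poly_Mapping.keys p. (\<Sum>v\<in>Poly_Mapping.keys m. Poly_Mapping.lookup m v) = s)}"

definition hilbert_function :: "'v set \<Rightarrow> ('v, 'k::field) mpoly set \<Rightarrow> nat \<Rightarrow> nat"
  where "hilbert_function V I s =
    ring.dim (poly_ring V Quot I) (quot_scalars V I) (quot_graded_piece V I s)"

definition hilbert_series :: "'v set \<Rightarrow> ('v, 'k::field) mpoly set \<Rightarrow> rat fps"
  where "hilbert_series V I = Abs_fps (\<lambda>s. of_nat (hilbert_function V I s))"

text \<open>
  \<open>h\<close> is the \<open>h\<close>-vector \<open>(h 0, \<dots>, h \<delta>)\<close> of \<open>k[V]/I\<close>, where \<open>\<delta>\<close> is the Krull dimension, extended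
  by zeros beyond \<open>\<delta>\<close>.
\<close>

definition is_h_vector :: "'v set \<Rightarrow> ('v, 'k::field) mpoly set \<Rightarrow> (nat \<Rightarrow> int) \<Rightarrow> bool"
  where "is_h_vector V I h \<longleftrightarrow>
    (\<exists>\<delta>. krull_dim (poly_ring V Quot I) = enat \<delta> \<and>
         (\<forall>i>\<delta>. h i = 0) \<and>
         hilbert_series V I =
           (\<Sum>i\<le>\<delta>. fps_const (of_int (h i)) * fps_X ^ i) / (1 - fps_X) ^ \<delta>)"

end

theory Submission
  imports Defs
begin

text \<open>
  Write \<open>\<Delta>(H)\<close> for the independence complex of a graph \<open>H\<close>. The monomials whose support is a face of
  \<open>\<Delta>(G)\<close> form a basis of \<open>k[V]/I(G)\<close>, so the Hilbert series is the sum of \<open>(t/(1-t))\<^bsup>|F|\<^esup>\<close> over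
  the faces \<open>F\<close> of \<open>\<Delta>(G)\<close> (\<open>hilbert_series_edge_ideal\<close>), and it depends on the \<open>f\<close>-vector of
  \<open>\<Delta>(G)\<close> only. The variables outside a maximal face generate an associated prime; hence a regular
  edge meets every maximal face, and a perfect matching of \<open>d\<close> regular edges forces all maximal faces
  to have \<open>d\<close> elements. This makes \<open>d\<close> the Krull dimension, and the \<open>h\<close>-polynomial is the sum of
  \<open>t\<^bsup>|F|\<^esup> (1-t)\<^bsup>d-|F|\<^esup>\<close> over the faces of \<open>\<Delta>(G)\<close>.

  Whiskering at a regular edge preserves the \<open>f\<close>-vector. Indeed \<open>{x, y}\<close> is regular exactly when
  every neighbour of \<open>x\<close> is adjacent to every neighbour of \<open>y\<close>, so no independent set meets both
  neighbourhoods, and exchanging \<open>x\<close> and \<open>y\<close> in some of the faces is a bijection between \<open>\<Delta>(G)\<close> and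
  \<open>\<Delta>(G\<^sup>e)\<close> (\<open>f_vector_whisker_edges\<close>). The condition on the neighbourhoods of \<open>x\<^sub>i\<close> and \<open>y\<^sub>i\<close>
  keeps each \<open>e\<^sub>i\<close> regular after whiskering at the edges before it (\<open>whisker_along_matching\<close>). In the
  last graph every \<open>y\<^sub>i\<close> is a leaf attached to \<open>x\<^sub>i\<close>. Its independent sets consist of an independent
  set \<open>S\<close> of the graph induced on the \<open>x\<^sub>i\<close> and an arbitrary set of those \<open>y\<^sub>i\<close> with \<open>x\<^sub>i \<notin> S\<close>, so
  the \<open>h\<close>-polynomial is the sum over \<open>S\<close> of \<open>t\<^bsup>|S|\<^esup> (t + (1-t))\<^bsup>d-|S|\<^esup> = t\<^bsup>|S|\<^esup>\<close>
  (\<open>whiskered_face_sum\<close>), which is the claim.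

  The upper bound for the Krull dimension is a growth argument. Given primes \<open>P\<^sub>0 \<subset> \<dots> \<subset> P\<^sub>n\<close> over
  \<open>I(G)\<close>, choose \<open>f\<^sub>i \<in> P\<^sub>i - P\<^bsub>i-1\<^esub>\<close>. The \<open>t\<^sup>n\<close> products of powers of the \<open>f\<^sub>i\<close> with exponents below
  \<open>t\<close> are linearly independent modulo \<open>P\<^sub>0\<close> (\<open>prime_chain_independent_family\<close>), whereas the number of
  monomials with support in \<open>\<Delta>(G)\<close> and exponents linear in \<open>t\<close> is of order at most \<open>t\<^sup>d\<close>.
\<close>

section \<open>Independent sets and whiskering\<close>

lemma finite_graph_edge_vertices:
  assumes "finite_graph V E" "{a, b} \<in> E"
  shows "a \<in> V" "b \<in> V"
  using assms unfolding finite_graph_def by (metis doubleton_eq_iff)+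

lemma in_independence_complex_iff:
  assumes "finite_graph V E"
  shows "F \<in> independence_complex V E \<longleftrightarrow> F \<subseteq> V \<and> (\<forall>a\<in>F. \<forall>b\<in>F. {a, b} \<notin> E)"
  using assms unfolding independence_complex_def finite_graph_def
  by (auto; metis insert_subset empty_subsetI)

lemma whisker_edges_doubleton_iff:
  assumes "x \<noteq> y"
  shows "{a, b} \<in> whisker_edges E (x, y) \<longleftrightarrow>
    {a, b} \<in> E \<and> a \<noteq> y \<and> b \<noteq> y \<or> a = x \<and> b \<noteq> x \<and> {b, y} \<in> E \<or>
    b = x \<and> a \<noteq> x \<and> {a, y} \<in> E \<or> {a, b} = {x, y}"
  unfolding whisker_edges_def
  by (auto simp: doubleton_eq_iff insert_commute)

lemma finite_graph_whisker_edges: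
  assumes "finite_graph V E" "x \<in> V" "y \<in> V"
  shows "finite_graph V (whisker_edges E (x, y))"
  using assms finite_graph_edge_vertices[OF assms(1)]
  unfolding finite_graph_def whisker_edges_def by blast

lemma loopless_whisker_edges:
  assumes "loopless E" "x \<noteq> y"
  shows "loopless (whisker_edges E (x, y))"
  using assms whisker_edges_doubleton_iff[OF assms(2), of v v E for v]
  unfolding loopless_def by (auto simp: doubleton_eq_iff)

text \<open>
  The faces of the two complexes agree except for those that contain \<open>y\<close> and a \<open>G\<close>-neighbour of \<open>y\<close>
  in the whiskered graph, and those that contain \<open>x\<close> and a further neighbour of \<open>y\<close> in \<open>G\<close>. Replacing
  \<open>y\<close> by \<open>x\<close> matches the two kinds: a face with a neighbour of \<open>y\<close> contains no neighbour of \<open>x\<close>, by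
  the assumption that such vertices are adjacent.
\<close>

lemma f_vector_whisker_edges:
  assumes G: "finite_graph V E" and L: "loopless E" and e: "{x, y} \<in> E"
    and reg: "\<And>a b. {a, x} \<in> E \<Longrightarrow> {b, y} \<in> E \<Longrightarrow> {a, b} \<in> E"
  shows "f_vector (independence_complex V (whisker_edges E (x, y))) =
    f_vector (independence_complex V E)"
proof
  fix i
  have LE: "{a} \<notin> E" for a using L by (auto simp: loopless_def)
  have xy: "x \<noteq> y" using LE e by auto
  have xV: "x \<in> V" and yV: "y \<in> V" using finite_graph_edge_vertices[OF G e] .
  let ?W = "whisker_edges E (x, y)"
  have GW: "finite_graph V ?W" using finite_graph_whisker_edges[OF G xV yV] .
  note iG = in_independence_complex_iff[OF G] and iW = in_independence_complex_iff[OF GW]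
  note W = whisker_edges_doubleton_iff[OF xy]
  define to_G where "to_G F = (if y \<in> F \<and> (\<exists>a\<in>F. {a, y} \<in> E) then insert x (F - {y}) else F)" for F
  define to_W where "to_W F = (if x \<in> F \<and> (\<exists>a\<in>F - {x}. {a, y} \<in> E) then insert y (F - {x}) else F)" for F
  have 1: "to_W F \<in> independence_complex V ?W \<and> to_G (to_W F) = F \<and> card (to_W F) = card F"
    if F: "F \<in> independence_complex V E" for F
  proof (cases "x \<in> F \<and> (\<exists>a\<in>F - {x}. {a, y} \<in> E)")
    case True
    have fin: "finite F" using F G by (auto simp: iG finite_graph_def intro: finite_subset)
    have yF: "y \<notin> F" using F e True by (auto simp: iG)
    have eq: "to_W F = insert y (F - {x})" using True by (simp add: to_W_def)
    have "to_W F \<in> independence_complex V ?W"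
      using F yV xy unfolding eq iW W iG by (auto simp: doubleton_eq_iff)
    moreover have "to_G (to_W F) = F" using True yF xy unfolding eq to_G_def by auto
    moreover have "card (to_W F) = card F"
      unfolding eq using True yF fin
      by (metis DiffD1 card.remove card_insert_disjoint finite_Diff)
    ultimately show ?thesis by blast
  next
    case False
    then have eq: "to_W F = F" unfolding to_W_def by auto
    have "to_G F = F" using F unfolding to_G_def iG by auto
    moreover have "{x, y} \<subseteq> F \<Longrightarrow> False" using F e unfolding iG by auto
    then have "F \<in> independence_complex V ?W"
      using F False unfolding iW W iG by (auto simp: doubleton_eq_iff)
    ultimately show ?thesis by (simp add: eq)
  qed
  have 2: "to_G F \<in> independence_complex V E \<and> to_W (to_G F) = F"
    if F: "F \<in> independence_complex V ?W" for F
  proof (cases "y \<in> F \<and> (\<exists>a\<in>F. {a, y} \<in> E)")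
    case True
    then obtain a where a: "a \<in> F" "{a, y} \<in> E" by auto
    have xF: "x \<notin> F" using F True unfolding iW W by auto
    have ay: "a \<noteq> y" using a LE by auto
    have eq: "to_G F = insert x (F - {y})" using True by (simp add: to_G_def)
    have no: "{q, x} \<notin> E" if "q \<in> F - {y}" for q
    proof
      assume "{q, x} \<in> E"
      then have "{q, a} \<in> E" using reg a by blast
      then show False using F a ay that unfolding iW W by auto
    qed
    have "to_G F \<in> independence_complex V E"
      using F xV no LE no[unfolded insert_commute[of _ x]] unfolding eq iW W iG by auto
    moreover have "to_W (to_G F) = F" using True xF a ay unfolding eq to_W_def by auto
    ultimately show ?thesis by blast
  next
    case False
    then have eq: "to_G F = F" unfolding to_G_def by auto
    have "to_W F = F" using F unfolding to_W_def iW W by auto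
    moreover have "{y, a} \<notin> E" "{a, y} \<notin> E" if "a \<in> F" "y \<in> F" for a
      using that False by (auto simp: insert_commute)
    then have "F \<in> independence_complex V E"
      using F unfolding iW W iG by (metis)
    ultimately show ?thesis by (simp add: eq)
  qed
  let ?level = "\<lambda>\<Delta>. {F \<in> \<Delta>. int (card F) = i + 1}"
  have "bij_betw to_G (?level (independence_complex V ?W)) (?level (independence_complex V E))"
    by (rule bij_betw_byWitness[where f' = to_W]) (use 1 2 in \<open>force+\<close>)
  then show "f_vector (independence_complex V ?W) i = f_vector (independence_complex V E) i"
    unfolding f_vector_def by (rule bij_betw_same_card)
qed

text \<open>
  The invariant for whiskering \<open>E\<close> at \<open>{x 1, y 1}, \<dots>, {x j, y j}\<close>. The last three clauses describe the
  edges of \<open>H\<close> at the vertices that are not yet treated and at \<open>y 1, \<dots>, y j\<close>; the edges among the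
  vertices \<open>x 1, \<dots>, x j\<close> never influence a later step.
\<close>

definition whiskered_along ::
    "'v set \<Rightarrow> 'v set set \<Rightarrow> (nat \<Rightarrow> 'v) \<Rightarrow> (nat \<Rightarrow> 'v) \<Rightarrow> nat \<Rightarrow> 'v set set \<Rightarrow> bool"
  where "whiskered_along V E x y j H \<longleftrightarrow>
    finite_graph V H \<and> loopless H \<and>
    f_vector (independence_complex V H) = f_vector (independence_complex V E) \<and>
    (\<forall>u v. u \<notin> x ` {1..j} \<union> y ` {1..j} \<longrightarrow> v \<notin> x ` {1..j} \<union> y ` {1..j} \<longrightarrow>
      ({u, v} \<in> H \<longleftrightarrow> {u, v} \<in> E)) \<and>
    (\<forall>u. \<forall>i\<in>{1..j}. u \<notin> x ` {1..j} \<union> y ` {1..j} \<longrightarrow>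
      ({u, x i} \<in> H \<longleftrightarrow> {u, x i} \<in> E \<or> {u, y i} \<in> E)) \<and>
    (\<forall>u. \<forall>i\<in>{1..j}. {u, y i} \<in> H \<longleftrightarrow> u = x i)"

text \<open>
  The step from \<open>j\<close> to \<open>Suc j\<close> needs the next edge to be regular in the graph reached so far. One of
  its ends has no neighbour among the treated vertices and so keeps its neighbours. At the other end
  a neighbour \<open>y i\<close> has been traded for \<open>x i\<close>; but whoever was adjacent to \<open>y i\<close> and is untreated is
  adjacent to \<open>x i\<close> now.
\<close>

lemma whisker_along_matching:
  fixes V :: "'v set" and E :: "'v set set" and x y :: "nat \<Rightarrow> 'v"
  defines "H \<equiv> \<lambda>j. whisker_edges_list E (map (\<lambda>i. (x i, y i)) [1..<Suc j])"
  assumes G: "finite_graph V E" and L: "loopless E"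
    and e: "\<And>i. i \<in> {1..d} \<Longrightarrow> {x i, y i} \<in> E"
    and disj: "\<And>i j. i \<in> {1..d} \<Longrightarrow> j \<in> {1..d} \<Longrightarrow> i \<noteq> j \<Longrightarrow> {x i, y i} \<inter> {x j, y j} = {}"
    and reg: "\<And>i a b. i \<in> {1..d} \<Longrightarrow> {a, x i} \<in> E \<Longrightarrow> {b, y i} \<in> E \<Longrightarrow> {a, b} \<in> E"
    and nb: "\<And>i. i \<in> {2..d} \<Longrightarrow>
           neighbors E (x i) \<inter> (x ` {1..<i} \<union> y ` {1..<i}) = {} \<or>
           neighbors E (y i) \<inter> (x ` {1..<i} \<union> y ` {1..<i}) = {}"
    and j: "j \<le> d"
  shows "whiskered_along V E x y j (H j)"
  using j
proof (induction j)
  case 0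
  then show ?case using G L by (simp add: H_def whiskered_along_def whisker_edges_list_def)
next
  case (Suc j)
  define P where "P j = x ` {1..j} \<union> y ` {1..j}" for j
  define x' where "x' = x (Suc j)"
  define y' where "y' = y (Suc j)"
  have IH: "finite_graph V (H j)" "loopless (H j)"
     "f_vector (independence_complex V (H j)) = f_vector (independence_complex V E)"
    and a: "\<And>u v. u \<notin> P j \<Longrightarrow> v \<notin> P j \<Longrightarrow> {u, v} \<in> H j \<longleftrightarrow> {u, v} \<in> E"
    and b: "\<And>u i. i \<in> {1..j} \<Longrightarrow> u \<notin> P j \<Longrightarrow> {u, x i} \<in> H j \<longleftrightarrow> {u, x i} \<in> E \<or> {u, y i} \<in> E"
    and c: "\<And>u i. i \<in> {1..j} \<Longrightarrow> {u, y i} \<in> H j \<longleftrightarrow> u = x i"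
    using Suc unfolding whiskered_along_def P_def by auto
  have HS: "H (Suc j) = whisker_edges (H j) (x', y')"
    by (simp add: H_def x'_def y'_def whisker_edges_list_def)
  have PS: "P (Suc j) = insert x' (insert y' (P j))"
    unfolding P_def x'_def y'_def by (auto simp: atLeastAtMostSuc_conv)
  have eE: "{x', y'} \<in> E" using e[of "Suc j"] Suc.prems by (simp add: x'_def y'_def)
  have xy: "x' \<noteq> y'" using eE L by (auto simp: loopless_def)
  have new: "x i \<noteq> x'" "x i \<noteq> y'" "y i \<noteq> x'" "y i \<noteq> y'" if "i \<in> {1..j}" for i
    using disj[of i "Suc j"] that Suc.prems by (auto simp: x'_def y'_def)
  have notP: "x' \<notin> P j" "y' \<notin> P j"
    using new unfolding P_def by (metis UnE imageE)+
  have eH: "{x', y'} \<in> H j" using a notP eE by auto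
  have regE: "{u, v} \<in> E" if "{u, x'} \<in> E" "{v, y'} \<in> E" for u v
    using reg[of "Suc j"] that Suc.prems by (simp add: x'_def y'_def)
  \<comment> \<open>Regularity in \<open>H j\<close> when \<open>p\<close> is the end without treated neighbours; it is used for both
      orders of the ends \<open>x'\<close> and \<open>y'\<close>.\<close>
  have half: "{u, v} \<in> H j"
    if p: "p \<notin> P j" "q \<notin> P j" and pq: "\<And>u v. {u, p} \<in> E \<Longrightarrow> {v, q} \<in> E \<Longrightarrow> {u, v} \<in> E"
      and N: "neighbors E p \<inter> P j = {}" and u: "{u, p} \<in> H j" and v: "{v, q} \<in> H j" for p q u v
  proof -
    have ne: "{w, p} \<notin> E" if "w \<in> P j" for w using N that by (auto simp: neighbors_def)
    have P_cases: "\<exists>i\<in>{1..j}. w = x i \<or> w = y i" if "w \<in> P j" for w using that by (auto simp: P_def)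
    have inP: "x i \<in> P j" "y i \<in> P j" if "i \<in> {1..j}" for i using that by (auto simp: P_def)
    have uP: "u \<notin> P j"
    proof
      assume "u \<in> P j"
      then obtain i where i: "i \<in> {1..j}" "u = x i \<or> u = y i" using P_cases by blast
      then show False
        using u b[OF i(1) p(1)] c[OF i(1), of p] ne[of "x i"] ne[of "y i"] inP[OF i(1)] p(1)
        by (metis insert_commute)
    qed
    have uE: "{u, p} \<in> E" using a uP p(1) u by blast
    show ?thesis
    proof (cases "v \<in> P j")
      case False
      then show ?thesis using a p(2) v uP pq[OF uE] by blast
    next
      case True
      then obtain i where i: "i \<in> {1..j}" "v = x i \<or> v = y i" using P_cases by blast
      then have "{q, x i} \<in> E \<or> {q, y i} \<in> E" "v = x i"
        using v b[OF i(1) p(2)] c[OF i(1), of q] p(2) inP[OF i(1)] by (metis insert_commute)+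
      moreover have "{u, x i} \<in> H j" if "{q, x i} \<in> E \<or> {q, y i} \<in> E"
        using that b[OF i(1) uP] pq[OF uE] by (metis insert_commute)
      ultimately show ?thesis by simp
    qed
  qed
  \<comment> \<open>For \<open>j = 0\<close> nothing has been treated; the neighbourhood condition starts at the second edge.\<close>
  have "neighbors E x' \<inter> P j = {} \<or> neighbors E y' \<inter> P j = {}"
  proof (cases "j = 0")
    case True then show ?thesis by (simp add: P_def)
  next
    case False
    then show ?thesis using nb[of "Suc j"] Suc.prems
      by (simp add: P_def x'_def y'_def atLeastLessThanSuc_atLeastAtMost)
  qed
  then have regH: "{u, v} \<in> H j" if u: "{u, x'} \<in> H j" and v: "{v, y'} \<in> H j" for u v
  proof
    assume "neighbors E x' \<inter> P j = {}"
    then show ?thesis using half[OF notP regE _ u v] by blast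
  next
    have "{a, b} \<in> E" if "{a, y'} \<in> E" "{b, x'} \<in> E" for a b
      using regE[OF that(2,1)] by (simp add: insert_commute)
    moreover assume "neighbors E y' \<inter> P j = {}"
    ultimately have "{v, u} \<in> H j" using half[OF notP(2,1) _ _ v u] by blast
    then show ?thesis by (simp add: insert_commute)
  qed
  have "x' \<in> V" "y' \<in> V" using finite_graph_edge_vertices[OF G eE] .
  then have 1: "finite_graph V (H (Suc j))"
    unfolding HS by (rule finite_graph_whisker_edges[OF IH(1)])
  have ll: "loopless (H (Suc j))"
    unfolding HS by (rule loopless_whisker_edges[OF IH(2) xy])
  have 2: "f_vector (independence_complex V (H (Suc j))) = f_vector (independence_complex V E)"
    unfolding HS using f_vector_whisker_edges[OF IH(1,2) eH regH] IH(3) by simp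
  note W = whisker_edges_doubleton_iff[OF xy]
  have 3: "{u, v} \<in> H (Suc j) \<longleftrightarrow> {u, v} \<in> E" if "u \<notin> P (Suc j)" "v \<notin> P (Suc j)" for u v
    using that a[of u v] unfolding HS W PS by (auto simp: doubleton_eq_iff)
  have 4: "{u, x i} \<in> H (Suc j) \<longleftrightarrow> {u, x i} \<in> E \<or> {u, y i} \<in> E"
    if "i \<in> {1..Suc j}" "u \<notin> P (Suc j)" for u i
  proof (cases "i = Suc j")
    case True
    then have i: "x i = x'" "y i = y'" by (auto simp: x'_def y'_def)
    show ?thesis using that(2) notP a[of u x'] a[of u y'] xy unfolding HS W PS i
      by (auto simp: doubleton_eq_iff)
  next
    case False
    then have i: "i \<in> {1..j}" using that by auto
    show ?thesis using that(2) b[OF i, of u] new[OF i] unfolding HS W PS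
      by (auto simp: doubleton_eq_iff)
  qed
  have 5: "{u, y i} \<in> H (Suc j) \<longleftrightarrow> u = x i" if "i \<in> {1..Suc j}" for u i
  proof (cases "i = Suc j")
    case True
    then have i: "x i = x'" "y i = y'" by (auto simp: x'_def y'_def)
    show ?thesis using xy unfolding HS W i by (auto simp: doubleton_eq_iff)
  next
    case False
    then have i: "i \<in> {1..j}" using that by auto
    have "{y i, y'} \<notin> H j" using c[OF i, of y'] new[OF i] by (metis insert_commute)
    then show ?thesis using c[OF i, of u] new[OF i] unfolding HS W
      by (auto simp: doubleton_eq_iff)
  qed
  show ?case unfolding whiskered_along_def P_def[symmetric] by (intro conjI allI impI ballI) (rule 1 ll 2 3 4 5; assumption)+
qed

section \<open>Faces of a whiskered graph\<close>

lemma sum_over_faces_f_vector: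
  fixes g :: "nat \<Rightarrow> 'a::comm_semiring_1"
  assumes "finite \<Delta>" and "\<And>F. F \<in> \<Delta> \<Longrightarrow> card F \<le> d"
  shows "(\<Sum>F\<in>\<Delta>. g (card F)) = (\<Sum>i\<le>d. of_nat (f_vector \<Delta> (int i - 1)) * g i)"
proof -
  have "(\<Sum>F\<in>\<Delta>. g (card F)) = (\<Sum>i\<le>d. \<Sum>F\<in>{F \<in> \<Delta>. card F = i}. g (card F))"
    using assms sum.group[of \<Delta> "{..d}" card "\<lambda>F. g (card F)"] by (simp add: image_subset_iff)
  also have "\<dots> = (\<Sum>i\<le>d. of_nat (f_vector \<Delta> (int i - 1)) * g i)"
    by (intro sum.cong) (auto simp: f_vector_def)
  finally show ?thesis .
qed

text \<open>
  An independent set is a pair of an independent set \<open>S\<close> among the \<open>x i\<close> and any set \<open>T\<close> of leaves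
  \<open>y i\<close> with \<open>x i \<notin> S\<close>. There are \<open>d - card S\<close> such leaves, and summing over \<open>T\<close> expands
  \<open>(t + (1 - t)) ^ (d - card S) = 1\<close>.
\<close>

lemma whiskered_face_sum:
  fixes V :: "'v set" and E :: "'v set set" and x y :: "nat \<Rightarrow> 'v" and d :: nat and t :: "'a::comm_ring_1"
  defines "B \<equiv> x ` {1..d}"
  assumes G: "finite_graph V E" and V: "V = B \<union> y ` {1..d}"
    and inj: "inj_on x {1..d}" "inj_on y {1..d}" and disj: "B \<inter> y ` {1..d} = {}"
    and whisker: "\<And>i u. i \<in> {1..d} \<Longrightarrow> {u, y i} \<in> E \<longleftrightarrow> u = x i"
  shows "(\<Sum>F\<in>independence_complex V E. t ^ card F * (1 - t) ^ (d - card F)) =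
    (\<Sum>S\<in>independence_complex B (induced_edges E B). t ^ card S)"
proof -
  let ?\<Delta> = "independence_complex B (induced_edges E B)"
  define Y where "Y S = y ` {i \<in> {1..d}. x i \<notin> S}" for S
  let ?g = "\<lambda>n. t ^ n * (1 - t) ^ (d - n)"
  note iE = in_independence_complex_iff[OF G]
  have finB: "finite B" by (simp add: B_def)
  have GB: "finite_graph B (induced_edges E B)"
    unfolding finite_graph_def
  proof (intro conjI ballI)
    show "finite B" by (fact finB)
    fix e assume "e \<in> induced_edges E B"
    then have e: "e \<in> E" "e \<subseteq> B" by (auto simp: induced_edges_def)
    then obtain a b where "e = {a, b}" using G unfolding finite_graph_def by meson
    then show "\<exists>a\<in>B. \<exists>b\<in>B. e = {a, b}" using e(2) by auto
  qed
  have iB: "S \<in> ?\<Delta> \<longleftrightarrow> S \<subseteq> B \<and> (\<forall>a\<in>S. \<forall>b\<in>S. {a, b} \<notin> E)" for S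
    unfolding in_independence_complex_iff[OF GB] by (auto simp: induced_edges_def)
  have fB: "finite S" if "S \<in> ?\<Delta>" for S
    using that finB unfolding iB by (auto intro: finite_subset)
  have fin: "finite ?\<Delta>" by (rule finite_subset[of _ "Pow B"]) (auto simp: iB finB)
  have fY: "finite (Y S)" for S by (simp add: Y_def)
  have cY: "card (Y S) + card S = d" if "S \<in> ?\<Delta>" for S
  proof -
    have "S \<subseteq> x ` {1..d}" using that unfolding iB by (simp add: B_def)
    then have S: "S = x ` {i \<in> {1..d}. x i \<in> S}" by auto
    have "card S = card {i \<in> {1..d}. x i \<in> S}"
      by (subst S) (rule card_image[OF inj_on_subset[OF inj(1)]], auto)
    moreover have "card (Y S) = card {i \<in> {1..d}. x i \<notin> S}"
      unfolding Y_def by (rule card_image[OF inj_on_subset[OF inj(2)]]) auto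
    moreover have "card {i \<in> {1..d}. x i \<notin> S} + card {i \<in> {1..d}. x i \<in> S} = card {1..d}"
    proof -
      have "{1..d} = {i \<in> {1..d}. x i \<notin> S} \<union> {i \<in> {1..d}. x i \<in> S}" by auto
      then show ?thesis by (metis (no_types, lifting) card_Un_disjoint disjoint_iff finite_Un finite_atLeastAtMost mem_Collect_eq)
    qed
    ultimately show ?thesis by simp
  qed
  have "(\<Sum>F\<in>independence_complex V E. ?g (card F)) =
    (\<Sum>(S, T)\<in>Sigma ?\<Delta> (\<lambda>S. Pow (Y S)). ?g (card S + card T))"
  proof (rule sum.reindex_bij_witness[where i = "\<lambda>(S, T). S \<union> T" and j = "\<lambda>F. (F \<inter> B, F - B)"])
    fix F assume F: "F \<in> independence_complex V E"
    have "F - B \<subseteq> Y (F \<inter> B)"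
    proof
      fix b assume b: "b \<in> F - B"
      then have "b \<in> V" using F unfolding iE by blast
      then obtain i where i: "i \<in> {1..d}" "b = y i" using b unfolding V by blast
      have "{x i, b} \<in> E" using whisker[of i "x i"] i by simp
      then have "x i \<notin> F" using F b unfolding iE by blast
      then show "b \<in> Y (F \<inter> B)" unfolding Y_def using i by blast
    qed
    moreover have "F \<inter> B \<in> ?\<Delta>" using F unfolding iE iB by blast
    ultimately show "(\<lambda>F. (F \<inter> B, F - B)) F \<in> Sigma ?\<Delta> (\<lambda>S. Pow (Y S))"
      by simp
    have "finite F" using F G by (auto simp: iE finite_graph_def intro: finite_subset)
    then have "card F = card (F \<inter> B) + card (F - B)"
      by (rule card_Int_Diff)
    then show "(case (F \<inter> B, F - B) of (S, T) \<Rightarrow> ?g (card S + card T)) = ?g (card F)" by simp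
  next
    fix p assume "p \<in> Sigma ?\<Delta> (\<lambda>S. Pow (Y S))"
    then obtain S T where p: "p = (S, T)" "S \<in> ?\<Delta>" "T \<subseteq> Y S" by auto
    have SB: "S \<subseteq> B" using p by (simp add: iB)
    have TY: "T \<subseteq> y ` {1..d}" using p(3) unfolding Y_def by blast
    then have TB: "T \<inter> B = {}" "T \<subseteq> y ` {1..d}" using disj by blast+
    show "(\<lambda>F. (F \<inter> B, F - B)) (case p of (S, T) \<Rightarrow> S \<union> T) = p"
      using p SB TB by auto
    have T: "\<exists>i\<in>{1..d}. b = y i \<and> x i \<notin> S" if "b \<in> T" for b using p that unfolding Y_def by blast
    have no: "{a, b} \<notin> E" if a: "a \<in> S \<union> T" and b: "b \<in> T" for a b
    proof
      assume ab: "{a, b} \<in> E"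
      obtain i where i: "i \<in> {1..d}" "b = y i" "x i \<notin> S" using T[OF b] by blast
      then have "a = x i" using whisker[of i a] ab by simp
      moreover have "x i \<in> B" using i(1) by (simp add: B_def)
      ultimately show False using a i(3) TB(1) by blast
    qed
    have "{a, b} \<notin> E" if "a \<in> S \<union> T" "b \<in> S \<union> T" for a b
      using that no[of a b] no[of b a] p(2) by (auto simp: iB insert_commute)
    moreover have "S \<union> T \<subseteq> V" using SB TB(2) unfolding V by blast
    ultimately show "(case p of (S, T) \<Rightarrow> S \<union> T) \<in> independence_complex V E"
      unfolding p(1) by (simp add: iE)
  qed auto
  also have "\<dots> = (\<Sum>S\<in>?\<Delta>. \<Sum>T\<in>Pow (Y S). ?g (card S + card T))"
    by (rule sum.Sigma[symmetric]) (use fin fY in auto)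
  also have "\<dots> = (\<Sum>S\<in>?\<Delta>. t ^ card S)"
  proof (rule sum.cong[OF refl])
    fix S assume S: "S \<in> ?\<Delta>"
    have "(\<Sum>T\<in>Pow (Y S). ?g (card S + card T)) =
      (\<Sum>T\<in>Pow (Y S). t ^ card S * ((\<Prod>_\<in>T. t) * (\<Prod>_\<in>Y S - T. 1 - t)))"
    proof (rule sum.cong[OF refl])
      fix T assume T: "T \<in> Pow (Y S)"
      then have "finite T" using fY finite_subset by blast
      then have "d - (card S + card T) = card (Y S - T)"
        using T cY[OF S] by (subst card_Diff_subset) auto
      then show "?g (card S + card T) = t ^ card S * ((\<Prod>_\<in>T. t) * (\<Prod>_\<in>Y S - T. 1 - t))"
        by (simp add: power_add mult.assoc)
    qed
    also have "\<dots> = t ^ card S * (\<Prod>_\<in>Y S. t + (1 - t))"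
      by (simp only: prod_add[OF fY] sum_distrib_left)
    finally show "(\<Sum>T\<in>Pow (Y S). ?g (card S + card T)) = t ^ card S" by simp
  qed
  finally show ?thesis .
qed

section \<open>Polynomial rings and monomial ideals\<close>

lemma poly_ring_simps [simp]:
  "p \<otimes>\<^bsub>poly_ring V\<^esub> q = p * q" "p \<oplus>\<^bsub>poly_ring V\<^esub> q = p + q"
  "\<one>\<^bsub>poly_ring V\<^esub> = 1" "\<zero>\<^bsub>poly_ring V\<^esub> = 0"
  by (simp_all add: poly_ring_def)

lemma in_carrier_poly_ring_iff:
  "p \<in> carrier (poly_ring V) \<longleftrightarrow> (\<forall>m\<in>Poly_Mapping.keys p. Poly_Mapping.keys m \<subseteq> V)"
  by (simp add: poly_ring_def)

lemma keys_add_nat: "Poly_Mapping.keys (a + b :: 'v \<Rightarrow>\<^sub>0 nat) = Poly_Mapping.keys a \<union> Poly_Mapping.keys b"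
  by (auto simp: in_keys_iff lookup_add)

lemma keys_uminus: "Poly_Mapping.keys (- p :: 'a \<Rightarrow>\<^sub>0 'b::ab_group_add) = Poly_Mapping.keys p"
  by (auto simp: in_keys_iff)

lemma cring_poly_ring: "cring (poly_ring V)"
proof (rule cringI)
  show "abelian_group (poly_ring V)"
  proof (rule abelian_groupI)
    fix p assume p: "p \<in> carrier (poly_ring V)"
    show "\<exists>q\<in>carrier (poly_ring V). q \<oplus>\<^bsub>poly_ring V\<^esub> p = \<zero>\<^bsub>poly_ring V\<^esub>"
      by (rule bexI[of _ "- p"]) (use p in \<open>auto simp: in_carrier_poly_ring_iff keys_uminus\<close>)
  qed (auto simp: in_carrier_poly_ring_iff add_ac dest!: subsetD[OF keys_add])
  show "comm_monoid (poly_ring V)"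
    by (rule comm_monoidI)
      (auto simp: in_carrier_poly_ring_iff mult_ac keys_add_nat subset_iff
        dest!: subsetD[OF keys_mult])
qed (simp add: distrib_right)

lemma a_inv_poly_ring [simp]:
  assumes "p \<in> carrier (poly_ring V)"
  shows "\<ominus>\<^bsub>poly_ring V\<^esub> p = - p"
proof -
  interpret cring "poly_ring V" by (rule cring_poly_ring)
  have "- p \<in> carrier (poly_ring V)" using assms by (simp add: in_carrier_poly_ring_iff keys_uminus)
  then show ?thesis using assms by (intro minus_equality) auto
qed

lemma a_minus_poly_ring [simp]:
  assumes "q \<in> carrier (poly_ring V)"
  shows "p \<ominus>\<^bsub>poly_ring V\<^esub> q = p - q"
  using assms by (simp add: a_minus_def)

lemma sum_in_poly_ring_ideal:
  assumes "ideal J (poly_ring V)" "\<And>i. i \<in> A \<Longrightarrow> f i \<in> J"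
  shows "sum f A \<in> J"
  using assms(2)
proof (induction A rule: infinite_finite_induct)
  case (insert i A)
  then show ?case
    using additive_subgroup.a_closed[OF ideal.axioms(1)[OF assms(1)], of "f i" "sum f A"] by simp
qed (use additive_subgroup.zero_closed[OF ideal.axioms(1)[OF assms(1)]] in auto)

lemma sum_in_carrier_poly_ring:
  "(\<And>i. i \<in> A \<Longrightarrow> f i \<in> carrier (poly_ring V)) \<Longrightarrow> sum f A \<in> carrier (poly_ring V)"
  using ring.oneideal[OF cring.axioms(1)[OF cring_poly_ring]] by (rule sum_in_poly_ring_ideal)

lemma poly_mapping_eq_sum_single:
  "p = (\<Sum>m\<in>Poly_Mapping.keys p. Poly_Mapping.single m (Poly_Mapping.lookup p m))"
  by (rule poly_mapping_eqI)
    (auto simp: lookup_sum lookup_single when_def in_keys_iff)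

text \<open>
  The coefficients of a product as a finite sum, so that the usual rules for \<open>sum\<close> apply.
\<close>

lemma lookup_mult_keys:
  fixes p q :: "('a::monoid_add) \<Rightarrow>\<^sub>0 ('b::semiring_1)"
  shows "Poly_Mapping.lookup (p * q) k = (\<Sum>(a, b)\<in>Poly_Mapping.keys p \<times> Poly_Mapping.keys q.
    if a + b = k then Poly_Mapping.lookup p a * Poly_Mapping.lookup q b else 0)"
proof -
  have "p * q = (\<Sum>(a, b)\<in>Poly_Mapping.keys p \<times> Poly_Mapping.keys q.
      Poly_Mapping.single (a + b) (Poly_Mapping.lookup p a * Poly_Mapping.lookup q b))"
    by (subst poly_mapping_eq_sum_single[of p], subst poly_mapping_eq_sum_single[of q])
      (simp add: sum_product sum.cartesian_product mult_single)
  then show ?thesis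
    by (simp add: lookup_sum lookup_single when_def case_prod_unfold)
qed

lemma lookup_const_mult: "Poly_Mapping.lookup (const c * p) m = c * Poly_Mapping.lookup p m"
proof (cases "c = 0")
  case False
  then show ?thesis
    unfolding lookup_mult_keys
    by (auto simp: const_def sum.cartesian_product[symmetric] in_keys_iff)
qed (simp add: const_def)

text \<open>
  When \<open>N\<close> is closed under adding exponent vectors, this is the ideal spanned by the monomials in \<open>N\<close>
  with support in \<open>V\<close>.
\<close>

definition monomial_ideal :: "'v set \<Rightarrow> ('v \<Rightarrow>\<^sub>0 nat) set \<Rightarrow> ('v, 'k::field) mpoly set"
  where "monomial_ideal V N = {p \<in> carrier (poly_ring V). Poly_Mapping.keys p \<subseteq> N}"

lemma ideal_monomial_ideal:
  assumes "\<And>m m'. m \<in> N \<Longrightarrow> m' + m \<in> N"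
  shows "ideal (monomial_ideal V N) (poly_ring V)" (is "ideal ?I ?R")
proof -
  interpret cring ?R by (rule cring_poly_ring)
  have 1: "q * p \<in> ?I"
    if "p \<in> ?I" "q \<in> carrier (?R)" for p q
  proof -
    have "q * p \<in> carrier (?R)"
      using that m_closed[of q p] by (simp add: monomial_ideal_def)
    then show ?thesis
      using that assms by (auto simp: monomial_ideal_def dest!: subsetD[OF keys_mult])
  qed
  show ?thesis
  proof (rule idealI)
    show "subgroup (?I) (add_monoid (?R))"
    proof (rule add.subgroupI)
      fix p q assume pq: "p \<in> ?I" "q \<in> ?I"
      then have "p + q \<in> carrier (?R)"
        using a_closed[of p q] by (simp add: monomial_ideal_def)
      then show "p \<oplus>\<^bsub>?R\<^esub> q \<in> ?I"
        using pq by (auto simp: monomial_ideal_def dest!: subsetD[OF keys_add])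
    next
      fix p assume p: "p \<in> ?I"
      then have "\<ominus>\<^bsub>?R\<^esub> p = - p"
        by (simp add: monomial_ideal_def)
      then show "\<ominus>\<^bsub>?R\<^esub> p \<in> ?I"
        using p by (simp add: monomial_ideal_def in_carrier_poly_ring_iff keys_uminus)
    next
      have "0 \<in> ?I" by (simp add: monomial_ideal_def in_carrier_poly_ring_iff)
      then show "?I \<noteq> {}" by blast
    qed (auto simp: monomial_ideal_def)
  qed (use 1 in \<open>auto simp: ring_axioms mult.commute\<close>)
qed

lemma single_in_monomial_ideal:
  assumes "m \<in> N" "Poly_Mapping.keys m \<subseteq> V"
  shows "Poly_Mapping.single m c \<in> monomial_ideal V N"
  using assms by (simp add: monomial_ideal_def in_carrier_poly_ring_iff)

text \<open>
  The two ends of an edge are distinct, since there are no loops. Hence a monomial is divisible by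
  their product as soon as its support contains the edge.
\<close>

lemma edge_ideal_eq_monomial_ideal:
  assumes G: "finite_graph V E" and L: "loopless E"
  shows "(edge_ideal V E :: ('v, 'k::field) mpoly set) =
    monomial_ideal V {m. \<exists>e\<in>E. e \<subseteq> Poly_Mapping.keys m}" (is "_ = ?J")
proof -
  let ?I = "edge_ideal V E :: ('v, 'k) mpoly set"
  let ?gens = "{var u * var v :: ('v, 'k) mpoly | u v. {u, v} \<in> E}"
  interpret cring "poly_ring V :: ('v, 'k) mpoly ring" by (rule cring_poly_ring)
  have J: "ideal ?J (poly_ring V)"
    by (rule ideal_monomial_ideal) (auto simp: keys_add_nat)
  have var2: "var u * var v =
      (Poly_Mapping.single (Poly_Mapping.single u 1 + Poly_Mapping.single v 1) 1 :: ('v, 'k) mpoly)"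
    for u v by (simp add: var_def mult_single)
  have keys2: "Poly_Mapping.keys (Poly_Mapping.single u 1 + Poly_Mapping.single v (1::nat)) = {u, v}"
    for u v :: 'v by (auto simp: keys_add_nat)
  have gensJ: "?gens \<subseteq> ?J"
  proof clarify
    fix u v assume uv: "{u, v} \<in> E"
    show "(var u * var v :: ('v, 'k) mpoly) \<in> ?J"
      unfolding var2
      by (rule single_in_monomial_ideal)
        (use uv finite_graph_edge_vertices[OF G uv] keys2[of u v] in auto)
  qed
  then have gens: "?gens \<subseteq> carrier (poly_ring V)" by (auto simp: monomial_ideal_def)
  have idl: "ideal ?I (poly_ring V)"
    unfolding edge_ideal_def by (rule genideal_ideal[OF gens])
  show ?thesis
  proof
    show "?I \<subseteq> ?J"
      unfolding edge_ideal_def by (rule genideal_minimal[OF J gensJ])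
    show "?J \<subseteq> ?I"
    proof
      fix p assume p: "p \<in> ?J"
      have "Poly_Mapping.single m (Poly_Mapping.lookup p m) \<in> ?I"
        if m: "m \<in> Poly_Mapping.keys p" for m
      proof -
        obtain e where e: "e \<in> E" "e \<subseteq> Poly_Mapping.keys m"
          using p m by (auto simp: monomial_ideal_def)
        have "\<exists>u v. e = {u, v}" using G e(1) unfolding finite_graph_def by meson
        then obtain u v where uv: "e = {u, v}" by blast
        have "u \<noteq> v" using L e(1) uv by (auto simp: loopless_def)
        then have m_eq: "m = (m - (Poly_Mapping.single u 1 + Poly_Mapping.single v 1)) +
            (Poly_Mapping.single u 1 + Poly_Mapping.single v 1)"
          using e(2) uv
          by (intro poly_mapping_eqI)
            (auto simp: lookup_add lookup_minus lookup_single when_def in_keys_iff)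
        let ?q = "Poly_Mapping.single (m - (Poly_Mapping.single u 1 + Poly_Mapping.single v 1))
          (Poly_Mapping.lookup p m)"
        have "Poly_Mapping.keys (m - (Poly_Mapping.single u 1 + Poly_Mapping.single v 1)) \<subseteq>
            Poly_Mapping.keys m"
          by (auto simp: in_keys_iff lookup_minus)
        moreover have "Poly_Mapping.keys m \<subseteq> V"
          using p m by (auto simp: monomial_ideal_def in_carrier_poly_ring_iff)
        ultimately have "?q \<in> carrier (poly_ring V)"
          by (auto simp: in_carrier_poly_ring_iff)
        moreover have "var u * var v \<in> ?gens" using e(1) unfolding uv by blast
        then have "var u * var v \<in> ?I"
          unfolding edge_ideal_def by (rule subsetD[OF genideal_self[OF gens]])
        ultimately have "?q * (var u * var v) \<in> ?I"
          using ideal.I_l_closed[OF idl, of "var u * var v" ?q] by simp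
        then show ?thesis
          unfolding var2 mult_single m_eq[symmetric] by simp
      qed
      then have "(\<Sum>m\<in>Poly_Mapping.keys p. Poly_Mapping.single m (Poly_Mapping.lookup p m))
          \<in> ?I"
        by (rule sum_in_poly_ring_ideal[OF idl])
      then show "p \<in> ?I" using poly_mapping_eq_sum_single[of p] by simp
    qed
  qed
qed

section \<open>Primes generated by variables\<close>

text \<open>
  Such a weight takes the place of a monomial order when leading monomials are chosen. For a new
  variable \<open>v\<close> the exponent of \<open>v\<close> becomes the leading digit in a base \<open>M\<close> that exceeds the weights
  of the remaining parts.
\<close>

lemma additive_injective_weight:
  assumes "finite V" "finite A" "\<And>m. m \<in> A \<Longrightarrow> Poly_Mapping.keys m \<subseteq> V"
  shows "\<exists>w :: ('v \<Rightarrow>\<^sub>0 nat) \<Rightarrow> nat. (\<forall>a b. w (a + b) = w a + w b) \<and> inj_on w A"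
  using assms
proof (induction V arbitrary: A rule: finite_induct)
  case empty
  then have "A \<subseteq> {0}" by (auto intro!: poly_mapping_eqI simp: in_keys_iff)
  then have "inj_on (\<lambda>_. 0 :: nat) A" by (auto intro!: inj_onI)
  then show ?case by (intro exI[of _ "\<lambda>_. 0"]) simp
next
  case (insert v V)
  let ?r = "Poly_Mapping.update v (0::nat)"
  have r_add: "?r (a + b) = ?r a + ?r b" for a b
    by (rule poly_mapping_eqI) (simp add: lookup_update lookup_add)
  have "Poly_Mapping.keys m \<subseteq> V" if "m \<in> ?r ` A" for m
    using that insert.prems(2) by (force simp: keys_update)
  then obtain w :: "('v \<Rightarrow>\<^sub>0 nat) \<Rightarrow> nat"
    where w: "\<And>a b. w (a + b) = w a + w b" "inj_on w (?r ` A)"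
    using insert.IH[of "?r ` A"] insert.prems(1) by blast
  have "finite (w ` ?r ` A)" using insert.prems(1) by blast
  then obtain M where "\<forall>n\<in>w ` ?r ` A. n < M"
    using finite_nat_set_iff_bounded by metis
  then have M: "w (?r m) < M" if "m \<in> A" for m using that by simp
  let ?w = "\<lambda>m. Poly_Mapping.lookup m v * M + w (?r m)"
  have "inj_on ?w A"
  proof (rule inj_onI)
    fix a b assume ab: "a \<in> A" "b \<in> A" and eq: "?w a = ?w b"
    have "(p * M + r) div M = p" if "r < M" for p r :: nat
    proof -
      have "M \<noteq> 0" using that by simp
      then show ?thesis using that by simp
    qed
    then have "?w a div M = Poly_Mapping.lookup a v" "?w b div M = Poly_Mapping.lookup b v"
      using M[OF ab(1)] M[OF ab(2)] by blast+
    then have lv: "Poly_Mapping.lookup a v = Poly_Mapping.lookup b v" using eq by metis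
    then have "w (?r a) = w (?r b)" using eq by simp
    then have "?r a = ?r b" using w(2) ab by (auto dest: inj_onD)
    show "a = b"
    proof (rule poly_mapping_eqI)
      fix u
      show "Poly_Mapping.lookup a u = Poly_Mapping.lookup b u"
        using lv arg_cong[OF \<open>?r a = ?r b\<close>, of "\<lambda>m. Poly_Mapping.lookup m u"]
        by (cases "u = v") (auto simp: lookup_update)
    qed
  qed
  moreover have "?w (a + b) = ?w a + ?w b" for a b
    by (simp add: r_add w(1) lookup_add algebra_simps)
  ultimately show ?case by (intro exI[of _ ?w]) blast
qed

text \<open>
  Two polynomials outside the ideal have monomials that avoid \<open>C\<close>. The heaviest such monomials of the
  two factors multiply to a monomial that avoids \<open>C\<close> and arises from no other pair of monomials, so
  it occurs in the product.
\<close>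

lemma primeideal_variables:
  assumes V: "finite V"
  shows "primeideal (monomial_ideal V {m. Poly_Mapping.keys m \<inter> C \<noteq> {}} :: ('v, 'k::field) mpoly set)
    (poly_ring V)" (is "primeideal ?Q ?R")
proof (rule primeidealI)
  show "ideal ?Q ?R" by (rule ideal_monomial_ideal) (auto simp: keys_add_nat)
  show "cring ?R" by (rule cring_poly_ring)
  have "1 \<in> carrier ?R" "1 \<notin> ?Q" by (auto simp: monomial_ideal_def in_carrier_poly_ring_iff)
  then show "carrier ?R \<noteq> ?Q" by metis
  fix p q :: "('v, 'k) mpoly"
  assume p: "p \<in> carrier ?R" and q: "q \<in> carrier ?R" and "p \<otimes>\<^bsub>?R\<^esub> q \<in> ?Q"
  then have pq: "p * q \<in> ?Q" by simp
  let ?K = "\<lambda>p :: ('v, 'k) mpoly. {m \<in> Poly_Mapping.keys p. Poly_Mapping.keys m \<inter> C = {}}"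
  show "p \<in> ?Q \<or> q \<in> ?Q"
  proof (rule ccontr)
    assume "\<not> (p \<in> ?Q \<or> q \<in> ?Q)"
    then have ne: "?K p \<noteq> {}" "?K q \<noteq> {}" using p q by (auto simp: monomial_ideal_def)
    obtain w :: "('v \<Rightarrow>\<^sub>0 nat) \<Rightarrow> nat"
      where w: "\<And>a b. w (a + b) = w a + w b" "inj_on w (?K p \<union> ?K q)"
    proof -
      have "\<And>m. m \<in> ?K p \<union> ?K q \<Longrightarrow> Poly_Mapping.keys m \<subseteq> V"
        using p q unfolding in_carrier_poly_ring_iff by blast
      then show ?thesis
        using additive_injective_weight[OF V, of "?K p \<union> ?K q"] that by auto
    qed
    have ex_max: "\<exists>m\<in>K. \<forall>a\<in>K. w a \<le> w m" if "finite K" "K \<noteq> {}" for K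
    proof -
      have "Max (w ` K) \<in> w ` K" using that by (intro Max_in) auto
      then obtain m where "m \<in> K" "w m = Max (w ` K)" by auto
      moreover have "w a \<le> Max (w ` K)" if "a \<in> K" for a using that \<open>finite K\<close> by simp
      ultimately show ?thesis by (intro bexI[of _ m]) simp_all
    qed
    obtain m where m: "m \<in> ?K p" "\<And>a. a \<in> ?K p \<Longrightarrow> w a \<le> w m"
      using ex_max[of "?K p"] ne(1) by auto
    obtain n where n: "n \<in> ?K q" "\<And>a. a \<in> ?K q \<Longrightarrow> w a \<le> w n"
      using ex_max[of "?K q"] ne(2) by auto
    \<comment> \<open>A sum that avoids \<open>C\<close> has summands that avoid \<open>C\<close>, so maximality applies to both.\<close>
    have unique: "a = m \<and> b = n"
      if "a \<in> Poly_Mapping.keys p" "b \<in> Poly_Mapping.keys q" "a + b = m + n" for a b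
    proof -
      have "Poly_Mapping.keys a \<union> Poly_Mapping.keys b = Poly_Mapping.keys m \<union> Poly_Mapping.keys n"
        using that(3) keys_add_nat by metis
      then have ab: "a \<in> ?K p" "b \<in> ?K q" using that m(1) n(1) by auto
      have "w a + w b = w m + w n" using that(3) w(1) by metis
      then have "w a = w m" "w b = w n" using m(2)[OF ab(1)] n(2)[OF ab(2)] by linarith+
      then show ?thesis using w(2) ab m(1) n(1) by (auto dest: inj_onD)
    qed
    have "Poly_Mapping.lookup (p * q) (m + n) =
      (\<Sum>ab\<in>Poly_Mapping.keys p \<times> Poly_Mapping.keys q. if ab = (m, n)
        then Poly_Mapping.lookup p m * Poly_Mapping.lookup q n else 0)"
      unfolding lookup_mult_keys
    proof (rule sum.cong[OF refl])
      fix ab assume ab: "ab \<in> Poly_Mapping.keys p \<times> Poly_Mapping.keys q"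
      obtain a b where "ab = (a, b)" by force
      then show "(case ab of (a, b) \<Rightarrow> if a + b = m + n
          then Poly_Mapping.lookup p a * Poly_Mapping.lookup q b else 0) =
        (if ab = (m, n) then Poly_Mapping.lookup p m * Poly_Mapping.lookup q n else 0)"
        using ab unique[of a b] by (cases "a + b = m + n") auto
    qed
    also have "\<dots> = Poly_Mapping.lookup p m * Poly_Mapping.lookup q n"
      using m(1) n(1) by simp
    also have "\<dots> \<noteq> 0" using m(1) n(1) by (simp add: in_keys_iff)
    finally have "m + n \<in> Poly_Mapping.keys (p * q)" by (simp add: in_keys_iff)
    then have "Poly_Mapping.keys (m + n) \<inter> C \<noteq> {}" using pq by (auto simp: monomial_ideal_def)
    then show False using m(1) n(1) by (auto simp: keys_add_nat)
  qed
qed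

section \<open>Associated primes and regular edges\<close>

lemma ex_maximal_face:
  assumes "finite V" "F \<in> independence_complex V E"
  shows "\<exists>M\<in>independence_complex V E. F \<subseteq> M \<and>
    (\<forall>c\<in>V - M. insert c M \<notin> independence_complex V E)"
proof -
  have "finite (independence_complex V E)"
    by (rule finite_subset[of _ "Pow V"]) (use assms(1) in \<open>auto simp: independence_complex_def\<close>)
  then obtain M where M: "M \<in> independence_complex V E" "F \<subseteq> M"
    and max: "\<And>M'. M' \<in> independence_complex V E \<Longrightarrow> M \<subseteq> M' \<Longrightarrow> M = M'"
    using finite_has_maximal2[of "independence_complex V E" F] assms(2) by metis
  then have "insert c M \<notin> independence_complex V E" if "c \<in> V - M" for c
    using that by blast
  then show ?thesis using M by blast
qed

text \<open>
  The ideal generated by the variables outside \<open>M\<close> is the annihilator of the product of the variables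
  in \<open>M\<close>: by maximality every further variable completes an edge together with vertices of \<open>M\<close>.
\<close>

lemma associated_prime_maximal_face:
  assumes G: "finite_graph V E" and L: "loopless E"
    and M: "M \<in> independence_complex V E"
    and max: "\<And>c. c \<in> V - M \<Longrightarrow> insert c M \<notin> independence_complex V E"
  shows "associated_prime (poly_ring V) (edge_ideal V E)
    (monomial_ideal V {m. Poly_Mapping.keys m \<inter> (V - M) \<noteq> {}} :: ('v, 'k::field) mpoly set)"
    (is "associated_prime ?R ?I ?Q")
proof -
  have V: "finite V" using G by (simp add: finite_graph_def)
  have MV: "M \<subseteq> V" and finM: "finite M"
    using M V by (auto simp: independence_complex_def intro: finite_subset)
  have Q: "primeideal ?Q ?R" by (rule primeideal_variables[OF V])
  note I = edge_ideal_eq_monomial_ideal[OF G L, where ?'k = 'k]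
  define m where "m = (\<Sum>v\<in>M. Poly_Mapping.single v (1::nat))"
  have km: "Poly_Mapping.keys m = M"
  proof -
    have "Poly_Mapping.lookup m v = (if v \<in> M then 1 else 0)" for v
      using finM by (simp add: m_def lookup_sum lookup_single when_def)
    then show ?thesis by (simp add: set_eq_iff in_keys_iff)
  qed
  define f where "f = (Poly_Mapping.single m 1 :: ('v, 'k) mpoly)"
  have f: "f \<in> carrier ?R" using MV by (simp add: f_def in_carrier_poly_ring_iff km)
  have IQ: "?I \<subseteq> ?Q"
  proof
    fix p assume p: "p \<in> ?I"
    have "Poly_Mapping.keys m \<inter> (V - M) \<noteq> {}" if m: "m \<in> Poly_Mapping.keys p" for m
    proof -
      obtain e where "e \<in> E" "e \<subseteq> Poly_Mapping.keys m"
        using p m unfolding I monomial_ideal_def by blast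
      moreover have "\<not> e \<subseteq> M" using M \<open>e \<in> E\<close> unfolding independence_complex_def by blast
      moreover have "Poly_Mapping.keys m \<subseteq> V"
        using p m unfolding I monomial_ideal_def in_carrier_poly_ring_iff by blast
      ultimately show ?thesis by blast
    qed
    then show "p \<in> ?Q" using p unfolding I monomial_ideal_def by blast
  qed
  have mem: "r * f \<in> ?I \<longleftrightarrow> r \<in> ?Q" if r: "r \<in> carrier ?R" for r
  proof
    assume "r * f \<in> ?I"
    then have "r \<otimes>\<^bsub>?R\<^esub> f \<in> ?Q" using IQ by auto
    moreover have "f \<notin> ?Q" by (simp add: f_def monomial_ideal_def km)
    ultimately show "r \<in> ?Q" using primeideal.I_prime[OF Q r f] by blast
  next
    assume rQ: "r \<in> ?Q"
    have "r * f \<in> carrier ?R"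
      using cring.cring_simprules(5)[OF cring_poly_ring r f] by simp
    moreover have "\<exists>e\<in>E. e \<subseteq> Poly_Mapping.keys k" if k: "k \<in> Poly_Mapping.keys (r * f)" for k
    proof -
      obtain a where a: "a \<in> Poly_Mapping.keys r" "k = a + m"
        using subsetD[OF keys_mult k] by (auto simp: f_def)
      then obtain c where c: "c \<in> Poly_Mapping.keys a" "c \<in> V - M"
        using rQ by (auto simp: monomial_ideal_def)
      have "insert c M \<subseteq> V" using c(2) MV by blast
      then obtain e where e: "e \<in> E" "e \<subseteq> insert c M"
        using max[OF c(2)] unfolding independence_complex_def by blast
      have "e \<subseteq> Poly_Mapping.keys k"
        using e(2) c(1) unfolding a(2) keys_add_nat km by blast
      then show ?thesis using e(1) by blast
    qed
    ultimately show "r * f \<in> ?I" unfolding I monomial_ideal_def by blast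
  qed
  have "?Q \<subseteq> carrier ?R" unfolding monomial_ideal_def by blast
  then have "?Q = {r \<in> carrier ?R. r \<otimes>\<^bsub>?R\<^esub> f \<in> ?I}"
    unfolding poly_ring_simps using mem by blast
  with f Q show ?thesis unfolding associated_prime_def by blast
qed

text \<open>
  Otherwise both variables lie in the associated prime that belongs to \<open>M\<close>, and their product lies in
  its square.
\<close>

lemma regular_edge_meets_maximal_face:
  fixes V :: "'v set"
  assumes G: "finite_graph V E" and L: "loopless E"
    and reg: "regular_edge TYPE('k::field) V E x y"
    and M: "M \<in> independence_complex V E"
    and max: "\<And>c. c \<in> V - M \<Longrightarrow> insert c M \<notin> independence_complex V E"
  shows "x \<in> M \<or> y \<in> M"
proof (rule ccontr)
  assume "\<not> (x \<in> M \<or> y \<in> M)"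
  moreover have "{x, y} \<in> E" using reg by (simp add: regular_edge_def)
  ultimately have xy: "x \<in> V - M" "y \<in> V - M"
    using finite_graph_edge_vertices[OF G] by blast+
  let ?Q = "monomial_ideal V {m. Poly_Mapping.keys m \<inter> (V - M) \<noteq> {}} :: ('v, 'k) mpoly set"
  have "var x \<in> ?Q" "var y \<in> ?Q"
    unfolding var_def using xy by (auto intro!: single_in_monomial_ideal)
  then have "var x * var y \<in> ?Q \<cdot>\<^bsub>poly_ring V\<^esub> ?Q"
    using ideal_prod.prod[of "var x" ?Q "var y" ?Q "poly_ring V"] by simp
  then show False
    using reg associated_prime_maximal_face[OF G L M max, where ?'k = 'k]
    unfolding regular_edge_def by blast
qed

text \<open>
  If \<open>a\<close> and \<open>b\<close> are not adjacent, a maximal independent set that contains both avoids \<open>x\<close> and \<open>y\<close>.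
  This covers \<open>a = b\<close>, as there are no loops: the ends of a regular edge have no common neighbour.
\<close>

lemma regular_edge_neighbors_adjacent:
  assumes G: "finite_graph V E" and L: "loopless E"
    and reg: "regular_edge TYPE('k::field) V E x y"
    and a: "{a, x} \<in> E" and b: "{b, y} \<in> E"
  shows "{a, b} \<in> E"
proof (rule ccontr)
  assume ab: "{a, b} \<notin> E"
  have V: "finite V" using G by (simp add: finite_graph_def)
  have "a \<in> V" "b \<in> V"
    using finite_graph_edge_vertices(1)[OF G a] finite_graph_edge_vertices(1)[OF G b] .
  then have "{a, b} \<in> independence_complex V E"
    using ab L unfolding in_independence_complex_iff[OF G] loopless_def
    by (simp add: insert_commute)
  from ex_maximal_face[OF V this] obtain M
    where M: "M \<in> independence_complex V E" "{a, b} \<subseteq> M"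
      and max: "\<And>c. c \<in> V - M \<Longrightarrow> insert c M \<notin> independence_complex V E"
    by blast
  have "x \<in> M \<or> y \<in> M" by (rule regular_edge_meets_maximal_face[OF G L reg M(1) max])
  moreover have "\<And>p q. p \<in> M \<Longrightarrow> q \<in> M \<Longrightarrow> {p, q} \<notin> E"
    using M(1) unfolding in_independence_complex_iff[OF G] by blast
  ultimately show False using M(2) a b by blast
qed

section \<open>Krull dimension\<close>

lemma homogeneous_system_nontrivial_solution:
  fixes \<beta> :: "'a \<Rightarrow> 'm \<Rightarrow> 'k::field"
  assumes "finite M" "finite A" "card M < card A"
  shows "\<exists>c. (\<exists>a\<in>A. c a \<noteq> 0) \<and> (\<forall>m\<in>M. (\<Sum>a\<in>A. c a * \<beta> a m) = 0)"
  using assms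
proof (induction M arbitrary: A \<beta> rule: finite_induct)
  case empty
  then have "A \<noteq> {}" by auto
  then show ?case by (intro exI[of _ "\<lambda>_. 1"]) auto
next
  case (insert m M)
  show ?case
  proof (cases "\<forall>a\<in>A. \<beta> a m = 0")
    case True
    have "card M < card A" using insert by simp
    then obtain c where "\<exists>a\<in>A. c a \<noteq> 0" "\<forall>m\<in>M. (\<Sum>a\<in>A. c a * \<beta> a m) = 0"
      using insert.IH[OF insert.prems(1), of \<beta>] by blast
    then show ?thesis using True by (intro exI[of _ c]) simp
  next
    case False
    then obtain a0 where a0: "a0 \<in> A" "\<beta> a0 m \<noteq> 0" by blast
    define A' where "A' = A - {a0}"
    have A': "finite A'" "a0 \<notin> A'" "A = insert a0 A'" using insert.prems a0 by (auto simp: A'_def)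
    then have "card M < card A'" using insert by simp
    then obtain c where c: "\<exists>a\<in>A'. c a \<noteq> 0"
      "\<And>n. n \<in> M \<Longrightarrow> (\<Sum>a\<in>A'. c a * (\<beta> a n - \<beta> a m / \<beta> a0 m * \<beta> a0 n)) = 0"
      using insert.IH[OF A'(1), of "\<lambda>a n. \<beta> a n - \<beta> a m / \<beta> a0 m * \<beta> a0 n"] by blast
    \<comment> \<open>The unknown \<open>a0\<close> is eliminated with the equation \<open>m\<close>; \<open>s\<close> is its value.\<close>
    define s where "s = - (\<Sum>a\<in>A'. c a * \<beta> a m) / \<beta> a0 m"
    have eq: "(\<Sum>a\<in>A. (c(a0 := s)) a * \<beta> a n) = s * \<beta> a0 n + (\<Sum>a\<in>A'. c a * \<beta> a n)" for n
    proof -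
      have "(\<Sum>a\<in>A'. (c(a0 := s)) a * \<beta> a n) = (\<Sum>a\<in>A'. c a * \<beta> a n)"
        using A'(2) by (intro sum.cong) auto
      then show ?thesis using A' by simp
    qed
    have "(\<Sum>a\<in>A. (c(a0 := s)) a * \<beta> a n) = 0" if "n \<in> insert m M" for n
    proof (cases "n = m")
      case True
      then show ?thesis using a0(2) unfolding eq by (simp add: s_def)
    next
      case False
      then have "(\<Sum>a\<in>A'. c a * \<beta> a n) - (\<Sum>a\<in>A'. c a * \<beta> a m) / \<beta> a0 m * \<beta> a0 n = 0"
        using c(2)[of n] that
        by (simp add: algebra_simps sum_subtractf sum_distrib_left sum_divide_distrib)
      then show ?thesis unfolding eq by (simp add: s_def)
    qed
    moreover have "\<exists>a\<in>A. (c(a0 := s)) a \<noteq> 0" using c(1) A' by auto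
    ultimately show ?thesis by (intro exI[of _ "c(a0 := s)"]) simp
  qed
qed

text \<open>
  Linear independence over \<open>k\<close> of the residue classes of the family \<open>b\<close> in \<open>k[V]/P\<close>.
\<close>

definition independent_modulo ::
    "('v, 'k::field) mpoly set \<Rightarrow> 'i set \<Rightarrow> ('i \<Rightarrow> ('v, 'k) mpoly) \<Rightarrow> bool"
  where "independent_modulo P A b \<longleftrightarrow>
    (\<forall>c. (\<Sum>a\<in>A. const (c a) * b a) \<in> P \<longrightarrow> (\<forall>a\<in>A. c a = 0))"

lemma const_in_carrier [simp]: "const c \<in> carrier (poly_ring V)"
  by (simp add: const_def in_carrier_poly_ring_iff)

lemma mult_in_carrier_poly_ring:
  "p \<in> carrier (poly_ring V) \<Longrightarrow> q \<in> carrier (poly_ring V) \<Longrightarrow> p * q \<in> carrier (poly_ring V)"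
  using cring.cring_simprules(5)[OF cring_poly_ring, of p V q] by simp

lemma power_in_carrier_poly_ring:
  "p \<in> carrier (poly_ring V) \<Longrightarrow> p ^ n \<in> carrier (poly_ring V)"
  by (induction n) (simp_all add: mult_in_carrier_poly_ring in_carrier_poly_ring_iff[of 1])

text \<open>
  In a relation modulo \<open>P\<close> all terms with \<open>j > 0\<close> vanish modulo \<open>Q\<close>, so the coefficients with \<open>j = 0\<close>
  vanish by independence modulo \<open>Q\<close>. What remains is a multiple of \<open>f\<close>, which can be cancelled modulo
  the prime \<open>P\<close>.
\<close>

lemma independent_modulo_powers:
  fixes P Q :: "('v, 'k::field) mpoly set"
  assumes P: "primeideal P (poly_ring V)" and Q: "ideal Q (poly_ring V)" and PQ: "P \<subseteq> Q"
    and f: "f \<in> Q" "f \<notin> P"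
    and b: "\<And>a. a \<in> A \<Longrightarrow> b a \<in> carrier (poly_ring V)"
    and ind: "independent_modulo Q A b"
  shows "independent_modulo P ({..<t} \<times> A) (\<lambda>(j, a). f ^ j * b a)"
proof -
  let ?R = "poly_ring V :: ('v, 'k) mpoly ring"
  define S where "S c = (\<Sum>a\<in>A. const (c a) * b a)" for c
  have fR: "f \<in> carrier ?R" using ideal.Icarr[OF Q] f(1) by blast
  have SR: "S c \<in> carrier ?R" for c
    unfolding S_def by (intro sum_in_carrier_poly_ring mult_in_carrier_poly_ring const_in_carrier b)
  have main: "\<forall>j<t. \<forall>a\<in>A. c j a = 0" if "(\<Sum>j<t. f ^ j * S (c j)) \<in> P" for c
    using that
  proof (induction t arbitrary: c)
    case (Suc t)
    define r where "r = (\<Sum>j<t. f ^ j * S (c (Suc j)))"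
    have r: "r \<in> carrier ?R"
      unfolding r_def
      by (intro sum_in_carrier_poly_ring mult_in_carrier_poly_ring power_in_carrier_poly_ring fR SR)
    have eq: "(\<Sum>j<Suc t. f ^ j * S (c j)) = S (c 0) + f * r"
      unfolding r_def by (simp add: sum.lessThan_Suc_shift sum_distrib_left mult.assoc
        del: sum.lessThan_Suc)
    have frQ: "f * r \<in> Q" using ideal.I_r_closed[OF Q f(1) r] by simp
    have "(S (c 0) + f * r) \<ominus>\<^bsub>?R\<^esub> f * r \<in> Q"
      using PQ Suc.prems frQ additive_subgroup.a_closed[OF ideal.axioms(1)[OF Q]]
        additive_subgroup.a_inv_closed[OF ideal.axioms(1)[OF Q]]
      unfolding eq a_minus_def by blast
    then have "S (c 0) \<in> Q" using mult_in_carrier_poly_ring[OF fR r] by simp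
    then have c0: "\<forall>a\<in>A. c 0 a = 0" using ind unfolding independent_modulo_def S_def by blast
    then have "S (c 0) = 0" by (simp add: S_def const_def)
    then have "f \<otimes>\<^bsub>?R\<^esub> r \<in> P" using Suc.prems unfolding eq by simp
    then have "r \<in> P" using primeideal.I_prime[OF P fR r] f(2) by blast
    then have "\<forall>j<t. \<forall>a\<in>A. c (Suc j) a = 0" using Suc.IH[of "\<lambda>j. c (Suc j)"] by (simp add: r_def)
    then show ?case using c0 by (auto simp: less_Suc_eq_0_disj)
  qed simp
  have eq: "(\<Sum>ja\<in>{..<t} \<times> A. const (c ja) * (case ja of (j, a) \<Rightarrow> f ^ j * b a)) =
      (\<Sum>j<t. f ^ j * S (\<lambda>a. c (j, a)))" for c
    unfolding S_def sum_distrib_left sum.cartesian_product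
    by (intro sum.cong) (auto simp: mult.left_commute)
  show ?thesis
    unfolding independent_modulo_def
  proof (intro allI impI ballI)
    fix c ja
    assume sum: "(\<Sum>ja\<in>{..<t} \<times> A. const (c ja) * (case ja of (j, a) \<Rightarrow> f ^ j * b a)) \<in> P"
      and ja: "ja \<in> {..<t} \<times> A"
    have "\<forall>j<t. \<forall>a\<in>A. c (j, a) = 0" using main[of "\<lambda>j a. c (j, a)"] sum unfolding eq by blast
    then show "c ja = 0" using ja by (cases ja) simp
  qed
qed

text \<open>
  The bound is on the exponent of each variable and not on the total degree, because the number of
  monomials with support in \<open>F\<close> is then at most \<open>(s + 1) ^ card F\<close>.
\<close>

definition exponents_le :: "nat \<Rightarrow> ('v, 'k::field) mpoly \<Rightarrow> bool"
  where "exponents_le s p \<longleftrightarrow> (\<forall>m\<in>Poly_Mapping.keys p. \<forall>v. Poly_Mapping.lookup m v \<le> s)"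

lemma exponents_le_mono: "exponents_le s p \<Longrightarrow> s \<le> r \<Longrightarrow> exponents_le r p"
  unfolding exponents_le_def by (meson order_trans)

lemma exponents_le_one: "exponents_le s 1"
  by (simp add: exponents_le_def)

lemma exponents_le_mult:
  assumes "exponents_le s p" "exponents_le r q"
  shows "exponents_le (s + r) (p * q)"
  unfolding exponents_le_def
proof (intro ballI allI)
  fix k v assume "k \<in> Poly_Mapping.keys (p * q)"
  then obtain a b where "a \<in> Poly_Mapping.keys p" "b \<in> Poly_Mapping.keys q" "k = a + b"
    using keys_mult by blast
  then show "Poly_Mapping.lookup k v \<le> s + r"
    using assms by (simp add: exponents_le_def lookup_add add_mono)
qed

lemma exponents_le_power: "exponents_le s p \<Longrightarrow> exponents_le (n * s) (p ^ n)"
  by (induction n) (simp_all add: exponents_le_one exponents_le_mult)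

lemma ex_exponents_le: "\<exists>s. exponents_le s p"
proof -
  let ?s = "\<Sum>m\<in>Poly_Mapping.keys p. \<Sum>v\<in>Poly_Mapping.keys m. Poly_Mapping.lookup m v"
  have "Poly_Mapping.lookup m v \<le> ?s" if m: "m \<in> Poly_Mapping.keys p" for m v
  proof (cases "v \<in> Poly_Mapping.keys m")
    case True
    then have "Poly_Mapping.lookup m v \<le> (\<Sum>v\<in>Poly_Mapping.keys m. Poly_Mapping.lookup m v)"
      by (intro member_le_sum) auto
    also have "\<dots> \<le> ?s" using m by (intro member_le_sum) auto
    finally show ?thesis .
  qed (simp add: in_keys_iff)
  then show ?thesis unfolding exponents_le_def by blast
qed

text \<open>
  The family consists of the products of powers \<open>f\<^sub>i ^ j\<^sub>i\<close> with \<open>j\<^sub>i < t\<close> and \<open>f\<^sub>i \<in> P (Suc i) - P i\<close>, and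
  \<open>e\<close> is the sum of bounds for the exponents in the \<open>f\<^sub>i\<close>. The lists of the \<open>j\<^sub>i\<close> are the indices. A
  longer chain is thus visible as a faster growth of the number of independent elements.
\<close>

lemma prime_chain_independent_family:
  fixes P :: "nat \<Rightarrow> ('v, 'k::field) mpoly set"
  assumes "\<And>i. i \<le> n \<Longrightarrow> primeideal (P i) (poly_ring V)"
    and "\<And>i. i < n \<Longrightarrow> P i \<subset> P (Suc i)"
  shows "\<exists>e. \<forall>t. \<exists>(A :: nat list set) b. finite A \<and> card A = t ^ n \<and>
    independent_modulo (P 0) A b \<and>
    (\<forall>a\<in>A. b a \<in> carrier (poly_ring V) \<and> exponents_le (t * e) (b a))"
  using assms
proof (induction n arbitrary: P)
  case 0
  have P: "primeideal (P 0) (poly_ring V)" using 0 by simp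
  have "c = 0" if "const c \<in> P 0" for c
  proof (rule ccontr)
    assume "c \<noteq> 0"
    have "const (inverse c) * const c \<in> P 0"
      using ideal.I_l_closed[OF primeideal.axioms(1)[OF P] that, of "const (inverse c)"] by simp
    then have "\<one>\<^bsub>poly_ring V\<^esub> \<in> P 0" using \<open>c \<noteq> 0\<close> by (simp add: const_def mult_single)
    then show False
      using ideal.one_imp_carrier[OF primeideal.axioms(1)[OF P]] primeideal.I_notcarr[OF P] by simp
  qed
  then have "independent_modulo (P 0) {[] :: nat list} (\<lambda>_. 1)"
    by (simp add: independent_modulo_def)
  moreover have "1 \<in> carrier (poly_ring V)" by (simp add: in_carrier_poly_ring_iff)
  ultimately show ?case
    by (intro exI[of _ 0] allI exI[of _ "{[]}"] exI[of _ "\<lambda>_. 1"]) (simp add: exponents_le_one)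
next
  case (Suc n)
  obtain e where e: "\<And>t. \<exists>(A :: nat list set) b. finite A \<and> card A = t ^ n \<and>
      independent_modulo (P (Suc 0)) A b \<and>
      (\<forall>a\<in>A. b a \<in> carrier (poly_ring V) \<and> exponents_le (t * e) (b a))"
    using Suc.IH[of "\<lambda>i. P (Suc i)"] Suc.prems by auto
  have P0: "primeideal (P 0) (poly_ring V)" and P1: "ideal (P (Suc 0)) (poly_ring V)"
    using Suc.prems(1)[of 0] primeideal.axioms(1)[OF Suc.prems(1)[of "Suc 0"]] by simp_all
  have P01: "P 0 \<subset> P (Suc 0)" using Suc.prems(2)[of 0] by simp
  then obtain f where f: "f \<in> P (Suc 0)" "f \<notin> P 0" by blast
  have fR: "f \<in> carrier (poly_ring V)" using ideal.Icarr[OF P1 f(1)] .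
  obtain s where s: "exponents_le s f" using ex_exponents_le by blast
  show ?case
  proof (intro exI[of _ "s + e"] allI)
    fix t
    obtain A :: "nat list set" and b where A: "finite A" "card A = t ^ n"
        and ind: "independent_modulo (P (Suc 0)) A b"
        and b: "\<And>a. a \<in> A \<Longrightarrow> b a \<in> carrier (poly_ring V)"
          "\<And>a. a \<in> A \<Longrightarrow> exponents_le (t * e) (b a)"
      using e[of t] by blast
    let ?cons = "\<lambda>(j, a). j # a"
    let ?A = "?cons ` ({..<t} \<times> A)"
    let ?b = "\<lambda>l. f ^ hd l * b (tl l)"
    have inj: "inj_on ?cons ({..<t} \<times> A)" by (auto intro: inj_onI)
    have "independent_modulo (P 0) ({..<t} \<times> A) (\<lambda>(j, a). f ^ j * b a)"
      using independent_modulo_powers[OF P0 P1 _ f b(1) ind] P01 by blast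
    then have "independent_modulo (P 0) ?A ?b"
      unfolding independent_modulo_def sum.reindex[OF inj] by (fastforce simp: case_prod_unfold)
    moreover have "finite ?A" using A(1) by simp
    moreover have "card ?A = t ^ Suc n" using A by (simp add: card_image[OF inj] card_cartesian_product)
    moreover have "?b l \<in> carrier (poly_ring V) \<and> exponents_le (t * (s + e)) (?b l)" if "l \<in> ?A" for l
    proof -
      obtain j a where l: "l = j # a" "j < t" "a \<in> A" using \<open>l \<in> ?A\<close> by auto
      have "exponents_le (j * s + t * e) (f ^ j * b a)"
        by (intro exponents_le_mult exponents_le_power s b l)
      moreover have "j * s + t * e \<le> t * (s + e)" using l(2) by (simp add: algebra_simps)
      ultimately show ?thesis
        using l b(1) fR exponents_le_mono
        by (auto intro: mult_in_carrier_poly_ring power_in_carrier_poly_ring)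
    qed
    ultimately show "\<exists>(A :: nat list set) b. finite A \<and> card A = t ^ Suc n \<and>
      independent_modulo (P 0) A b \<and>
      (\<forall>a\<in>A. b a \<in> carrier (poly_ring V) \<and> exponents_le (t * (s + e)) (b a))"
      by blast
  qed
qed

lemma card_bounded_monomials:
  fixes F :: "'v set"
  assumes "finite F"
  shows "finite {m :: 'v \<Rightarrow>\<^sub>0 nat. Poly_Mapping.keys m \<subseteq> F \<and> (\<forall>v. Poly_Mapping.lookup m v \<le> s)} \<and>
    card {m :: 'v \<Rightarrow>\<^sub>0 nat. Poly_Mapping.keys m \<subseteq> F \<and> (\<forall>v. Poly_Mapping.lookup m v \<le> s)}
      \<le> (s + 1) ^ card F"
    (is "finite ?M \<and> card ?M \<le> _")
proof -
  let ?r = "\<lambda>m. restrict (Poly_Mapping.lookup m) F"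
  have inj: "inj_on ?r ?M"
  proof (rule inj_onI, rule poly_mapping_eqI)
    fix m n v assume mn: "m \<in> ?M" "n \<in> ?M" "?r m = ?r n"
    show "Poly_Mapping.lookup m v = Poly_Mapping.lookup n v"
    proof (cases "v \<in> F")
      case True
      then show ?thesis using fun_cong[OF mn(3), of v] by simp
    next
      case False
      then have "v \<notin> Poly_Mapping.keys m" "v \<notin> Poly_Mapping.keys n" using mn by auto
      then show ?thesis by (simp add: in_keys_iff)
    qed
  qed
  have img: "?r ` ?M \<subseteq> F \<rightarrow>\<^sub>E {..s}" by auto
  have fin: "finite (F \<rightarrow>\<^sub>E {..s})" using assms by (intro finite_PiE) auto
  have "finite ?M" using finite_imageD[OF finite_subset[OF img fin] inj] .
  moreover have "card ?M \<le> card (F \<rightarrow>\<^sub>E {..s})" using card_inj_on_le[OF inj img fin] .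
  ultimately show ?thesis using assms by (simp add: card_PiE)
qed

text \<open>
  Modulo the ideal every \<open>b a\<close> is a combination of the monomials in \<open>M\<close>, and more than \<open>card M\<close> such
  combinations satisfy a linear relation.
\<close>

lemma independent_modulo_card_le:
  fixes b :: "'i \<Rightarrow> ('v, 'k::field) mpoly"
  assumes A: "finite A" and M: "finite M"
    and b: "\<And>a. a \<in> A \<Longrightarrow> b a \<in> carrier (poly_ring V)"
      "\<And>a. a \<in> A \<Longrightarrow> Poly_Mapping.keys (b a) \<subseteq> M \<union> N"
    and P: "monomial_ideal V N \<subseteq> P" and ind: "independent_modulo P A b"
  shows "card A \<le> card M"
proof (rule ccontr)
  assume "\<not> card A \<le> card M"
  then obtain c where c: "\<exists>a\<in>A. c a \<noteq> 0"
    "\<And>m. m \<in> M \<Longrightarrow> (\<Sum>a\<in>A. c a * Poly_Mapping.lookup (b a) m) = 0"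
    using homogeneous_system_nontrivial_solution[OF M A, of "\<lambda>a. Poly_Mapping.lookup (b a)"] by auto
  let ?p = "\<Sum>a\<in>A. const (c a) * b a"
  have lp: "Poly_Mapping.lookup ?p m = (\<Sum>a\<in>A. c a * Poly_Mapping.lookup (b a) m)" for m
    by (simp add: lookup_sum lookup_const_mult)
  have "?p \<in> carrier (poly_ring V)"
    by (intro sum_in_carrier_poly_ring mult_in_carrier_poly_ring const_in_carrier b)
  moreover have "m \<in> N" if m: "m \<in> Poly_Mapping.keys ?p" for m
  proof -
    have "m \<notin> M" using m c(2)[of m] by (auto simp: in_keys_iff lp)
    moreover have "\<exists>a\<in>A. m \<in> Poly_Mapping.keys (b a)"
    proof (rule ccontr)
      assume "\<not> (\<exists>a\<in>A. m \<in> Poly_Mapping.keys (b a))"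
      then have "Poly_Mapping.lookup ?p m = 0" unfolding lp by (simp add: in_keys_iff)
      then show False using m by (simp add: in_keys_iff)
    qed
    ultimately show ?thesis using b(2) by blast
  qed
  ultimately have "?p \<in> P" using P by (auto simp: monomial_ideal_def)
  then show False using ind c(1) unfolding independent_modulo_def by blast
qed

text \<open>
  A chain of length \<open>d + 1\<close> would give \<open>t ^ (d + 1)\<close> independent elements with exponents at most
  \<open>t * e\<close>. The monomials with such exponents and with a face as support number at most \<open>K * t ^ d\<close>
  for a constant \<open>K\<close>, which is too few for \<open>t = K + 1\<close>.
\<close>

lemma prime_chain_length_le:
  fixes P :: "nat \<Rightarrow> ('v, 'k::field) mpoly set"
  assumes G: "finite_graph V E" and L: "loopless E"
    and d: "\<And>F. F \<in> independence_complex V E \<Longrightarrow> card F \<le> d"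
    and prime: "\<And>i. i \<le> n \<Longrightarrow> primeideal (P i) (poly_ring V)"
    and strict: "\<And>i. i < n \<Longrightarrow> P i \<subset> P (Suc i)"
    and I: "edge_ideal V E \<subseteq> P 0"
  shows "n \<le> d"
proof (rule ccontr)
  assume "\<not> n \<le> d"
  then have dn: "Suc d \<le> n" by simp
  let ?\<Delta> = "independence_complex V E"
  let ?N = "{m. \<exists>e\<in>E. e \<subseteq> Poly_Mapping.keys m}"
  have V: "finite V" using G by (simp add: finite_graph_def)
  have fin: "finite ?\<Delta>"
    by (rule finite_subset[of _ "Pow V"]) (use V in \<open>auto simp: independence_complex_def\<close>)
  have finF: "finite F" if "F \<in> ?\<Delta>" for F
    using that V by (auto simp: independence_complex_def intro: finite_subset)
  obtain e where e: "\<And>t. \<exists>(A :: nat list set) b. finite A \<and> card A = t ^ Suc d \<and>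
    independent_modulo (P 0) A b \<and>
    (\<forall>a\<in>A. b a \<in> carrier (poly_ring V) \<and> exponents_le (t * e) (b a))"
  proof -
    have "primeideal (P i) (poly_ring V)" if "i \<le> Suc d" for i using prime that dn by simp
    moreover have "P i \<subset> P (Suc i)" if "i < Suc d" for i using strict that dn by simp
    ultimately show ?thesis using prime_chain_independent_family[of "Suc d" P V] that by auto
  qed
  let ?K = "card ?\<Delta> * (e + 1) ^ d"
  let ?t = "?K + 1"
  obtain A :: "nat list set" and b where A: "finite A" "card A = ?t ^ Suc d"
    and ind: "independent_modulo (P 0) A b"
    and b: "\<And>a. a \<in> A \<Longrightarrow> b a \<in> carrier (poly_ring V)"
      "\<And>a. a \<in> A \<Longrightarrow> exponents_le (?t * e) (b a)"
    using e[of ?t] by blast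
  let ?B = "\<lambda>F. {m :: 'v \<Rightarrow>\<^sub>0 nat. Poly_Mapping.keys m \<subseteq> F \<and> (\<forall>v. Poly_Mapping.lookup m v \<le> ?t * e)}"
  let ?M = "\<Union>F\<in>?\<Delta>. ?B F"
  have M: "finite ?M" using fin finF card_bounded_monomials by blast
  have "Poly_Mapping.keys (b a) \<subseteq> ?M \<union> ?N" if "a \<in> A" for a
  proof
    fix m assume m: "m \<in> Poly_Mapping.keys (b a)"
    show "m \<in> ?M \<union> ?N"
    proof (cases "m \<in> ?N")
      case False
      have "Poly_Mapping.keys m \<subseteq> V"
        using b(1)[OF that] m unfolding in_carrier_poly_ring_iff by blast
      then have "Poly_Mapping.keys m \<in> ?\<Delta>" using False by (auto simp: independence_complex_def)
      moreover have "m \<in> ?B (Poly_Mapping.keys m)"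
        using b(2)[OF that] m by (simp add: exponents_le_def)
      ultimately show ?thesis by blast
    qed simp
  qed
  moreover have "monomial_ideal V ?N \<subseteq> P 0"
    using I unfolding edge_ideal_eq_monomial_ideal[OF G L] .
  ultimately have "card A \<le> card ?M"
    using independent_modulo_card_le[OF A(1) M b(1) _ _ ind] by blast
  also have "\<dots> \<le> (\<Sum>F\<in>?\<Delta>. card (?B F))" by (rule card_UN_le[OF fin])
  also have "\<dots> \<le> (\<Sum>F\<in>?\<Delta>. (?t * (e + 1)) ^ d)"
  proof (rule sum_mono)
    fix F assume F: "F \<in> ?\<Delta>"
    have "card (?B F) \<le> (?t * e + 1) ^ card F"
      using card_bounded_monomials[OF finF[OF F]] by blast
    also have "\<dots> \<le> (?t * e + 1) ^ d" by (rule power_increasing[OF d[OF F]]) simp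
    also have "\<dots> \<le> (?t * (e + 1)) ^ d" by (intro power_mono) (simp_all add: algebra_simps)
    finally show "card (?B F) \<le> (?t * (e + 1)) ^ d" .
  qed
  also have "\<dots> = ?K * ?t ^ d" by (simp only: sum_constant of_nat_id power_mult_distrib mult_ac)
  also have "\<dots> < ?t * ?t ^ d" by simp
  finally show False using A(2) by simp
qed

lemma coset_eq_iff:
  assumes "ideal I (poly_ring V)" "p \<in> carrier (poly_ring V)" "q \<in> carrier (poly_ring V)"
  shows "I +>\<^bsub>poly_ring V\<^esub> p = I +>\<^bsub>poly_ring V\<^esub> q \<longleftrightarrow> p - q \<in> I"
  using ring.quotient_eq_iff_same_a_r_cos[OF cring.axioms(1)[OF cring_poly_ring] assms] assms(3)
  by simp

lemma krull_dim_quotient_le: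
  assumes G: "finite_graph V E" and L: "loopless E"
    and d: "\<And>F. F \<in> independence_complex V E \<Longrightarrow> card F \<le> d"
  shows "krull_dim (poly_ring V Quot (edge_ideal V E :: ('v, 'k::field) mpoly set)) \<le> enat d"
  unfolding krull_dim_def
proof (rule Sup_least, clarify)
  let ?R = "poly_ring V :: ('v, 'k) mpoly ring"
  let ?I = "edge_ideal V E :: ('v, 'k) mpoly set"
  fix n c assume c: "prime_chain (?R Quot ?I) n c"
  have I: "ideal ?I ?R"
    unfolding edge_ideal_eq_monomial_ideal[OF G L]
    by (rule ideal_monomial_ideal) (auto simp: keys_add_nat)
  have hom: "ring_hom_ring ?R (?R Quot ?I) ((+>\<^bsub>?R\<^esub>) ?I)"
    by (rule ideal.rcos_ring_hom_ring[OF I])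
  interpret h: ring_hom_ring ?R "?R Quot ?I" "(+>\<^bsub>?R\<^esub>) ?I" by (rule hom)
  define P where "P i = {r \<in> carrier ?R. ?I +>\<^bsub>?R\<^esub> r \<in> c i}" for i
  have prime: "primeideal (P i) ?R" if "i \<le> n" for i
    unfolding P_def using ring_hom_ring.primeideal_vimage[OF hom cring_poly_ring] c that
    by (simp add: prime_chain_def)
  have strict: "P i \<subset> P (Suc i)" if i: "i < n" for i
  proof -
    have sub: "c i \<subset> c (Suc i)" and "primeideal (c (Suc i)) (?R Quot ?I)"
      using c i by (simp_all add: prime_chain_def)
    then obtain z where z: "z \<in> c (Suc i)" "z \<notin> c i" by blast
    then have "z \<in> carrier (?R Quot ?I)"
      using ideal.Icarr[OF primeideal.axioms(1)[OF \<open>primeideal (c (Suc i)) _\<close>]] by blast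
    then obtain r where r: "r \<in> carrier ?R" "z = ?I +>\<^bsub>?R\<^esub> r"
      by (auto simp: FactRing_def A_RCOSETS_def')
    show ?thesis using sub r z unfolding P_def by blast
  qed
  have "?I \<subseteq> P 0"
  proof
    fix p assume p: "p \<in> ?I"
    have pR: "p \<in> carrier ?R" using ideal.Icarr[OF I p] .
    have "?I +>\<^bsub>?R\<^esub> p = \<zero>\<^bsub>?R Quot ?I\<^esub>"
      using coset_eq_iff[OF I pR, of 0] p h.hom_zero by (simp add: in_carrier_poly_ring_iff)
    moreover have "\<zero>\<^bsub>?R Quot ?I\<^esub> \<in> c 0"
      using c additive_subgroup.zero_closed[OF ideal.axioms(1)[OF primeideal.axioms(1)]]
      by (auto simp: prime_chain_def)
    ultimately show "p \<in> P 0" using pR by (simp add: P_def)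
  qed
  then have "n \<le> d"
    using prime_chain_length_le[where P = P and n = n, OF G L d prime strict] by blast
  then show "enat n \<le> enat d" by simp
qed

lemma primeideal_quotient_image:
  assumes R: "cring R" and I: "ideal I R" and J: "primeideal J R" and IJ: "I \<subseteq> J"
  shows "primeideal ((+>\<^bsub>R\<^esub>) I ` J) (R Quot I)"
    and "\<And>r. r \<in> carrier R \<Longrightarrow> I +>\<^bsub>R\<^esub> r \<in> (+>\<^bsub>R\<^esub>) I ` J \<longleftrightarrow> r \<in> J"
proof -
  let ?J = "(+>\<^bsub>R\<^esub>) I ` J"
  have ring: "ring R" by (rule cring.axioms(1)[OF R])
  have JR: "ideal J R" by (rule primeideal.axioms(1)[OF J])
  have J': "ideal ?J (R Quot I)" by (rule ring.ring_ideal_imp_quot_ideal[OF ring I JR])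
  have sub: "?J \<subseteq> carrier (R Quot I)" using ideal.Icarr[OF J'] by blast
  have "\<Union> ?J = J" using ring.ideal_incl_iff[OF ring I JR] IJ by simp
  then show mem: "I +>\<^bsub>R\<^esub> r \<in> ?J \<longleftrightarrow> r \<in> J" if "r \<in> carrier R" for r
    using ring.canonical_proj_vimage_mem_iff[OF ring I sub that] by simp
  show "primeideal ?J (R Quot I)"
  proof (rule primeidealI[OF J' ideal.quotient_is_cring[OF I R]])
    obtain r where "r \<in> carrier R" "r \<notin> J"
      using primeideal.I_notcarr[OF J] ideal.Icarr[OF JR] by blast
    then have "I +>\<^bsub>R\<^esub> r \<notin> ?J" "I +>\<^bsub>R\<^esub> r \<in> carrier (R Quot I)"
      using mem by (auto simp: FactRing_def A_RCOSETS_def')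
    then show "carrier (R Quot I) \<noteq> ?J" by metis
  next
    fix a b assume "a \<in> carrier (R Quot I)" "b \<in> carrier (R Quot I)"
      and ab: "a \<otimes>\<^bsub>R Quot I\<^esub> b \<in> ?J"
    then obtain p q where p: "p \<in> carrier R" "a = I +>\<^bsub>R\<^esub> p"
      and q: "q \<in> carrier R" "b = I +>\<^bsub>R\<^esub> q"
      by (auto simp: FactRing_def A_RCOSETS_def')
    have "a \<otimes>\<^bsub>R Quot I\<^esub> b = I +>\<^bsub>R\<^esub> (p \<otimes>\<^bsub>R\<^esub> q)"
      using ideal.rcoset_mult_add[OF I p(1) q(1)] p q by (simp add: FactRing_def)
    then have "p \<otimes>\<^bsub>R\<^esub> q \<in> J"
      using ab mem cring.cring_simprules(5)[OF R p(1) q(1)] by simp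
    then have "p \<in> J \<or> q \<in> J" using primeideal.I_prime[OF J p(1) q(1)] by blast
    then show "a \<in> ?J \<or> b \<in> ?J" using p q by blast
  qed
qed

text \<open>
  The chain starts at the prime generated by the variables outside \<open>M\<close>, and each step adds one
  variable from \<open>M\<close>.
\<close>

lemma krull_dim_quotient_ge:
  fixes V :: "'v set"
  assumes G: "finite_graph V E" and L: "loopless E" and M: "M \<in> independence_complex V E"
  shows "enat (card M) \<le> krull_dim (poly_ring V Quot (edge_ideal V E :: ('v, 'k::field) mpoly set))"
proof -
  let ?R = "poly_ring V :: ('v, 'k) mpoly ring"
  let ?I = "edge_ideal V E :: ('v, 'k) mpoly set"
  have V: "finite V" using G by (simp add: finite_graph_def)
  have MV: "M \<subseteq> V" using M by (simp add: independence_complex_def)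
  have I: "ideal ?I ?R"
    unfolding edge_ideal_eq_monomial_ideal[OF G L]
    by (rule ideal_monomial_ideal) (auto simp: keys_add_nat)
  obtain f where f: "bij_betw f {0..<card M} M"
    using ex_bij_betw_nat_finite[OF finite_subset[OF MV V]] by blast
  define C where "C i = (V - M) \<union> f ` {0..<i}" for i
  define Q where "Q i = (monomial_ideal V {m. Poly_Mapping.keys m \<inter> C i \<noteq> {}} :: ('v, 'k) mpoly set)"
    for i
  define c where "c i = (+>\<^bsub>?R\<^esub>) ?I ` Q i" for i
  have prime: "primeideal (Q i) ?R" for i
    unfolding Q_def by (rule primeideal_variables[OF V])
  have IQ: "?I \<subseteq> Q i" for i
  proof -
    have "Poly_Mapping.keys m \<inter> C i \<noteq> {}"
      if "e \<in> E" "e \<subseteq> Poly_Mapping.keys m" "e \<subseteq> V" for m :: "'v \<Rightarrow>\<^sub>0 nat" and e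
    proof -
      have "\<not> e \<subseteq> M" using M that(1) unfolding independence_complex_def by blast
      then show ?thesis using that unfolding C_def by blast
    qed
    moreover have "e \<subseteq> V" if e: "e \<in> E" for e
    proof -
      have "\<exists>a\<in>V. \<exists>b\<in>V. e = {a, b}" using G e by (simp add: finite_graph_def)
      then show ?thesis by auto
    qed
    ultimately show ?thesis
      unfolding edge_ideal_eq_monomial_ideal[OF G L] Q_def monomial_ideal_def by blast
  qed
  note image = primeideal_quotient_image[OF cring_poly_ring I prime IQ, folded c_def]
  have "c i \<subset> c (Suc i)" if i: "i < card M" for i
  proof -
    have fi: "f i \<in> M" using f i by (auto simp: bij_betw_def)
    have "f i \<notin> f ` {0..<i}"
      using f i by (auto simp: bij_betw_def dest!: inj_onD)
    then have no: "f i \<notin> C i" using fi by (simp add: C_def)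
    have yes: "f i \<in> C (Suc i)" by (simp add: C_def)
    have fV: "var (f i) \<in> carrier ?R" using fi MV by (auto simp: var_def in_carrier_poly_ring_iff)
    have "C i \<subseteq> C (Suc i)" unfolding C_def by (intro Un_mono image_mono) auto
    then have "Q i \<subseteq> Q (Suc i)" unfolding Q_def monomial_ideal_def by blast
    then have "c i \<subseteq> c (Suc i)" unfolding c_def by (rule image_mono)
    moreover have "var (f i) \<in> Q (Suc i)" "var (f i) \<notin> Q i"
      using no yes fV by (auto simp: Q_def monomial_ideal_def var_def)
    ultimately show ?thesis using image(2)[OF fV] by blast
  qed
  then have "prime_chain (?R Quot ?I) (card M) c"
    using image(1) by (simp add: prime_chain_def)
  then show ?thesis unfolding krull_dim_def by (intro Sup_upper) blast
qed

section \<open>Hilbert series\<close>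

lemma subfield_constants: "subfield (range const) (poly_ring V :: ('v, 'k::field) mpoly ring)"
proof -
  let ?R = "poly_ring V :: ('v, 'k) mpoly ring"
  interpret cring ?R by (rule cring_poly_ring)
  have const_mult: "const a * const b = (const (a * b) :: ('v, 'k) mpoly)" for a b
    by (simp add: const_def mult_single)
  have const_1: "const 1 = (1 :: ('v, 'k) mpoly)" by (simp add: const_def)
  have inj: "const a = (const b :: ('v, 'k) mpoly) \<longleftrightarrow> a = b" for a b
    by (metis const_def lookup_single_eq)
  have "subring (range const) ?R"
  proof (rule subringI)
    show "\<one>\<^bsub>?R\<^esub> \<in> range const" using const_1 by (metis poly_ring_simps(3) rangeI)
    fix p q :: "('v, 'k) mpoly" assume "p \<in> range const" "q \<in> range const"
    then obtain a b where pq: "p = const a" "q = const b" by blast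
    have "- const a = (const (- a) :: ('v, 'k) mpoly)"
      "const a + const b = (const (a + b) :: ('v, 'k) mpoly)"
      by (simp_all add: const_def single_uminus single_add)
    then show "\<ominus>\<^bsub>?R\<^esub> p \<in> range const" "p \<otimes>\<^bsub>?R\<^esub> q \<in> range const" "p \<oplus>\<^bsub>?R\<^esub> q \<in> range const"
      unfolding pq by (simp_all add: const_mult)
  qed auto
  then have "subcring (range const) ?R" by (rule subcringI')
  moreover have "Units (?R\<lparr>carrier := range const\<rparr>) = range const - {\<zero>\<^bsub>?R\<^esub>}"
  proof -
    have "(\<exists>b. const b * const a = (1 :: ('v, 'k) mpoly)) \<longleftrightarrow> a \<noteq> 0" for a
    proof -
      have "(\<exists>b. b * a = 1) \<longleftrightarrow> a \<noteq> (0 :: 'k)" by (metis left_inverse mult_zero_right zero_neq_one)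
      then show ?thesis unfolding const_mult const_1[symmetric] inj .
    qed
    moreover have "const a = (0 :: ('v, 'k) mpoly) \<longleftrightarrow> a = 0" for a
      using inj[of a 0] by (simp add: const_def)
    ultimately show ?thesis by (auto simp: Units_def mult.commute)
  qed
  ultimately show ?thesis by (rule subfieldI)
qed

lemma Span_monomials:
  assumes "\<And>m. m \<in> set ms \<Longrightarrow> Poly_Mapping.keys m \<subseteq> V"
  shows "ring.Span (poly_ring V) (range const) (map (\<lambda>m. Poly_Mapping.single m 1) ms) =
    {p :: ('v, 'k::field) mpoly. Poly_Mapping.keys p \<subseteq> set ms}"
  using assms
proof (induction ms)
  interpret cring "poly_ring V :: ('v, 'k) mpoly ring" by (rule cring_poly_ring)
  {
    case Nil
    then show ?case by auto
  next
    case (Cons m ms)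
    let ?E = "{p :: ('v, 'k) mpoly. Poly_Mapping.keys p \<subseteq> set ms}"
    have "Span (range const) (map (\<lambda>m. Poly_Mapping.single m 1) (m # ms)) =
        line_extension (range const) (Poly_Mapping.single m 1) ?E"
      using Cons by simp
    also have "\<dots> = {p. Poly_Mapping.keys p \<subseteq> set (m # ms)}" (is "?L = ?S")
    proof (intro Set.set_eqI iffI)
      fix p assume "p \<in> ?L"
      then obtain c v where "v \<in> ?E" "p = const c * Poly_Mapping.single m 1 + v"
        unfolding line_extension_mem_iff by auto
      then show "p \<in> ?S"
        using keys_add[of "Poly_Mapping.single m c" v]
        by (auto simp: const_def mult_single split: if_splits)
    next
      fix p assume p: "p \<in> ?S"
      let ?c = "Poly_Mapping.lookup p m"
      have "p = const ?c \<otimes>\<^bsub>poly_ring V\<^esub> Poly_Mapping.single m 1 \<oplus>\<^bsub>poly_ring V\<^esub> (p - Poly_Mapping.single m ?c)"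
        by (simp add: const_def mult_single)
      moreover have "p - Poly_Mapping.single m ?c \<in> ?E"
        using p by (auto simp: in_keys_iff lookup_minus lookup_single when_def split: if_splits)
      ultimately show "p \<in> ?L" unfolding line_extension_mem_iff by blast
    qed
    finally show ?case .
  }
qed

lemma independent_monomials:
  assumes "\<And>m. m \<in> set ms \<Longrightarrow> Poly_Mapping.keys m \<subseteq> V" "distinct ms"
  shows "ring.independent (poly_ring V) (range const)
    (map (\<lambda>m. Poly_Mapping.single m 1 :: ('v, 'k::field) mpoly) ms)"
  using assms
proof (induction ms)
  interpret cring "poly_ring V :: ('v, 'k) mpoly ring" by (rule cring_poly_ring)
  {
    case Nil
    then show ?case by simp
  next
    case (Cons m ms)
    let ?Us = "map (\<lambda>m. Poly_Mapping.single m 1 :: ('v, 'k) mpoly) ms"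
    have "Poly_Mapping.single m 1 \<notin> Span (range const) ?Us"
      using Span_monomials[of ms V, where ?'k = 'k] Cons.prems by simp
    moreover have "Poly_Mapping.single m 1 \<in> carrier (poly_ring V :: ('v, 'k) mpoly ring)"
      using Cons.prems by (simp add: in_carrier_poly_ring_iff)
    ultimately show ?case using Cons by (simp add: li_Cons)
  }
qed

text \<open>
  The argument is a set of supports, so that a single face \<open>F\<close> can be treated as \<open>{F}\<close>.
\<close>

definition monomials_of_degree :: "'v set set \<Rightarrow> nat \<Rightarrow> ('v \<Rightarrow>\<^sub>0 nat) set"
  where "monomials_of_degree \<Delta> s = {m. Poly_Mapping.keys m \<in> \<Delta> \<and>
    (\<Sum>v\<in>Poly_Mapping.keys m. Poly_Mapping.lookup m v) = s}"

lemma finite_monomials_of_degree: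
  assumes "finite V" "\<Delta> \<subseteq> Pow V"
  shows "finite (monomials_of_degree \<Delta> s)"
proof (rule finite_subset)
  show "finite {m. Poly_Mapping.keys m \<subseteq> V \<and> (\<forall>v. Poly_Mapping.lookup m v \<le> s)}"
    using card_bounded_monomials[OF assms(1)] by blast
  have "Poly_Mapping.lookup m v \<le> (\<Sum>v\<in>Poly_Mapping.keys m. Poly_Mapping.lookup m v)"
    for m :: "'a \<Rightarrow>\<^sub>0 nat" and v
    by (cases "v \<in> Poly_Mapping.keys m") (auto intro: member_le_sum simp: in_keys_iff)
  then show "monomials_of_degree \<Delta> s \<subseteq>
      {m. Poly_Mapping.keys m \<subseteq> V \<and> (\<forall>v. Poly_Mapping.lookup m v \<le> s)}"
    using assms(2) by (auto simp: monomials_of_degree_def)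
qed

text \<open>
  The residue classes of the monomials in question form a basis of the graded piece. They span it,
  because all other monomials lie in the ideal. For their independence it suffices that the quotient
  map is injective on the span of these monomials in \<open>k[V]\<close>, and this span meets the ideal only in \<open>0\<close>.
\<close>

lemma hilbert_function_edge_ideal:
  assumes G: "finite_graph V E" and L: "loopless E"
  shows "hilbert_function V (edge_ideal V E :: ('v, 'k::field) mpoly set) s =
    card (monomials_of_degree (independence_complex V E) s)"
proof -
  let ?R = "poly_ring V :: ('v, 'k) mpoly ring"
  let ?I = "edge_ideal V E :: ('v, 'k) mpoly set"
  let ?S = "?R Quot ?I"
  let ?h = "(+>\<^bsub>?R\<^esub>) ?I"
  let ?N = "monomials_of_degree (independence_complex V E) s"
  let ?D = "{m. \<exists>e\<in>E. e \<subseteq> Poly_Mapping.keys m}"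
  have V: "finite V" using G by (simp add: finite_graph_def)
  have I_eq: "?I = monomial_ideal V ?D" by (rule edge_ideal_eq_monomial_ideal[OF G L])
  have I: "ideal ?I ?R"
    unfolding I_eq by (rule ideal_monomial_ideal) (auto simp: keys_add_nat)
  interpret h: ring_hom_ring ?R ?S ?h by (rule ideal.rcos_ring_hom_ring[OF I])
  have "independence_complex V E \<subseteq> Pow V" by (auto simp: independence_complex_def)
  then have "finite ?N" by (rule finite_monomials_of_degree[OF V])
  then obtain ms where ms: "set ms = ?N" "distinct ms" using finite_distinct_list by blast
  have msV: "Poly_Mapping.keys m \<subseteq> V" if "m \<in> set ms" for m
    using that by (auto simp: ms monomials_of_degree_def independence_complex_def)
  have ND: "m \<notin> ?D" if "m \<in> ?N" for m
    using that by (auto simp: monomials_of_degree_def independence_complex_def)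
  let ?K = "range const :: ('v, 'k) mpoly set"
  let ?Us = "map (\<lambda>m. Poly_Mapping.single m 1 :: ('v, 'k) mpoly) ms"
  have K: "subfield ?K ?R" by (rule subfield_constants)
  have UsR: "set ?Us \<subseteq> carrier ?R" using msV by (auto simp: in_carrier_poly_ring_iff)
  have one_zero: "\<one>\<^bsub>?S\<^esub> \<noteq> \<zero>\<^bsub>?S\<^esub>"
  proof
    assume "\<one>\<^bsub>?S\<^esub> = \<zero>\<^bsub>?S\<^esub>"
    then have "?h 1 = ?h 0" using h.hom_one h.hom_zero by simp
    then have "1 \<in> ?I" using coset_eq_iff[OF I, of 1 0] by (simp add: in_carrier_poly_ring_iff)
    then have "{} \<in> E" by (simp add: I_eq monomial_ideal_def)
    then show False using G by (auto simp: finite_graph_def)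
  qed
  have Span: "h.R.Span ?K ?Us = {p. Poly_Mapping.keys p \<subseteq> ?N}"
    using Span_monomials[of ms V] msV ms(1) by blast
  have SpanR: "p \<in> carrier ?R" if "Poly_Mapping.keys p \<subseteq> ?N" for p
    using that msV unfolding ms(1) in_carrier_poly_ring_iff by blast
  have inj: "inj_on ?h (h.R.Span ?K ?Us)"
  proof (rule inj_onI)
    fix p q assume "p \<in> h.R.Span ?K ?Us" "q \<in> h.R.Span ?K ?Us" and eq: "?h p = ?h q"
    then have p: "Poly_Mapping.keys p \<subseteq> ?N" and q: "Poly_Mapping.keys q \<subseteq> ?N"
      unfolding Span by blast+
    have "p - q \<in> ?I" using eq coset_eq_iff[OF I SpanR[OF p] SpanR[OF q]] by blast
    then have "Poly_Mapping.keys (p - q) \<subseteq> ?D" by (simp add: I_eq monomial_ideal_def)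
    moreover have "Poly_Mapping.keys (p - q) \<subseteq> ?N"
    proof -
      have "Poly_Mapping.keys (p - q) \<subseteq> Poly_Mapping.keys p \<union> Poly_Mapping.keys q"
        by (auto simp: in_keys_iff lookup_minus)
      then show ?thesis using p q by blast
    qed
    ultimately have "Poly_Mapping.keys (p - q) = {}" using ND by blast
    then have "p - q = 0" using poly_mapping_eq_sum_single[of "p - q"] by simp
    then show "p = q" by simp
  qed
  have "h.R.independent ?K ?Us" by (rule independent_monomials[OF msV ms(2)])
  then have "ring.independent ?S (?h ` ?K) (map ?h ?Us)"
    by (rule h.inj_hom_preserves_independent[OF K one_zero inj])
  then have "ring.dimension ?S (length (map ?h ?Us)) (?h ` ?K) (ring.Span ?S (?h ` ?K) (map ?h ?Us))"
    by (rule h.S.dimension_independent)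
  moreover have "ring.Span ?S (?h ` ?K) (map ?h ?Us) = ?h ` h.R.Span ?K ?Us"
    by (rule h.Span_hom[OF _ UsR]) auto
  moreover have "?h ` h.R.Span ?K ?Us = quot_graded_piece V ?I s"
  proof
    show "?h ` h.R.Span ?K ?Us \<subseteq> quot_graded_piece V ?I s"
    proof
      fix z assume "z \<in> ?h ` h.R.Span ?K ?Us"
      then obtain p where p: "z = ?h p" "Poly_Mapping.keys p \<subseteq> ?N" unfolding Span by blast
      have "\<forall>m\<in>Poly_Mapping.keys p. (\<Sum>v\<in>Poly_Mapping.keys m. Poly_Mapping.lookup m v) = s"
        using p(2) unfolding monomials_of_degree_def by blast
      then show "z \<in> quot_graded_piece V ?I s"
        unfolding quot_graded_piece_def p(1) using SpanR[OF p(2)] by blast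
    qed
    show "quot_graded_piece V ?I s \<subseteq> ?h ` h.R.Span ?K ?Us"
    proof
      fix z assume "z \<in> quot_graded_piece V ?I s"
      then obtain p where z: "z = ?h p" and pR: "p \<in> carrier ?R"
        and hom: "\<And>m. m \<in> Poly_Mapping.keys p \<Longrightarrow>
          (\<Sum>v\<in>Poly_Mapping.keys m. Poly_Mapping.lookup m v) = s"
        unfolding quot_graded_piece_def by blast
      define q where "q = (\<Sum>m\<in>Poly_Mapping.keys p \<inter> ?N. Poly_Mapping.single m (Poly_Mapping.lookup p m))"
      have lq: "Poly_Mapping.lookup q m = (if m \<in> ?N then Poly_Mapping.lookup p m else 0)" for m
        by (auto simp: q_def lookup_sum lookup_single when_def in_keys_iff)
      have qN: "Poly_Mapping.keys q \<subseteq> ?N"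
      proof
        fix m assume "m \<in> Poly_Mapping.keys q"
        then show "m \<in> ?N" using lq[of m] by (simp add: in_keys_iff split: if_splits)
      qed
      have "p - q \<in> ?I"
      proof -
        have "p - q \<in> carrier ?R"
          using h.R.minus_closed[OF pR SpanR[OF qN]] SpanR[OF qN] by simp
        moreover have "m \<in> ?D" if m: "m \<in> Poly_Mapping.keys (p - q)" for m
        proof (rule ccontr)
          assume "m \<notin> ?D"
          have "m \<in> Poly_Mapping.keys p" "m \<notin> ?N"
            using m lq[of m] by (auto simp: in_keys_iff lookup_minus split: if_splits)
          moreover have "Poly_Mapping.keys m \<subseteq> V"
            using pR \<open>m \<in> Poly_Mapping.keys p\<close> unfolding in_carrier_poly_ring_iff by blast
          ultimately show False using \<open>m \<notin> ?D\<close> hom[of m]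
            by (auto simp: monomials_of_degree_def independence_complex_def)
        qed
        ultimately show ?thesis unfolding I_eq monomial_ideal_def by blast
      qed
      then have "?h p = ?h q" using coset_eq_iff[OF I pR SpanR[OF qN]] by blast
      then show "z \<in> ?h ` h.R.Span ?K ?Us" unfolding z Span using qN by blast
    qed
  qed
  moreover have "?h ` ?K = quot_scalars V ?I" by (auto simp: quot_scalars_def)
  ultimately have "ring.dimension ?S (length ms) (quot_scalars V ?I) (quot_graded_piece V ?I s)"
    by simp
  moreover have "subfield (quot_scalars V ?I) ?S"
    using h.img_is_subfield(2)[OF K one_zero] \<open>?h ` ?K = quot_scalars V ?I\<close> by simp
  ultimately have "ring.dim ?S (quot_scalars V ?I) (quot_graded_piece V ?I s) = length ms"
    using h.S.dimI unfolding over_def by blast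
  then show ?thesis
    using distinct_card[OF ms(2)] by (simp add: hilbert_function_def ms(1))
qed

text \<open>
  Here \<open>i\<close> is the degree of the part without \<open>v\<close>; the exponent \<open>s - i\<close> of \<open>v\<close> must be positive, which
  gives \<open>i < s\<close>.
\<close>

lemma card_monomials_insert:
  assumes F: "finite F" "v \<notin> F"
  shows "card (monomials_of_degree {insert v F} s) = (\<Sum>i<s. card (monomials_of_degree {F} i))"
proof -
  let ?S = "SIGMA i:{..<s}. monomials_of_degree {F} i"
  let ?f = "\<lambda>(i, m). m + Poly_Mapping.single v (s - i)"
  let ?g = "\<lambda>m. (s - Poly_Mapping.lookup m v, Poly_Mapping.update v (0::nat) m)"
  have F': "v \<notin> Poly_Mapping.keys m \<Longrightarrow> Poly_Mapping.lookup m v = 0" for m :: "'a \<Rightarrow>\<^sub>0 nat"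
    by (simp add: in_keys_iff)
  have 1: "?f p \<in> monomials_of_degree {insert v F} s \<and> ?g (?f p) = p" if "p \<in> ?S" for p
  proof -
    obtain i m where p: "p = (i, m)" "i < s" and k: "Poly_Mapping.keys m = F"
      and deg: "(\<Sum>u\<in>F. Poly_Mapping.lookup m u) = i"
      using \<open>p \<in> ?S\<close> by (auto simp: monomials_of_degree_def)
    have mv: "Poly_Mapping.lookup m v = 0" using F' F(2) k by blast
    have kp: "Poly_Mapping.keys (?f p) = insert v F" using p by (simp add: keys_add_nat k)
    have "(\<Sum>u\<in>F. Poly_Mapping.lookup (?f p) u) = (\<Sum>u\<in>F. Poly_Mapping.lookup m u)"
      by (rule sum.cong) (use F(2) p in \<open>auto simp: lookup_add lookup_single when_def\<close>)
    moreover have "Poly_Mapping.lookup (?f p) v = s - i"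
      using p mv by (simp add: lookup_add)
    ultimately have "(\<Sum>u\<in>insert v F. Poly_Mapping.lookup (?f p) u) = s"
      using F p(2) deg by simp
    moreover have "Poly_Mapping.update v 0 (?f p) = m"
      by (rule poly_mapping_eqI)
        (use p mv in \<open>auto simp: lookup_update lookup_add lookup_single when_def\<close>)
    ultimately show ?thesis
      using kp \<open>Poly_Mapping.lookup (?f p) v = s - i\<close> p
      by (simp add: monomials_of_degree_def)
  qed
  have 2: "?g m \<in> ?S \<and> ?f (?g m) = m" if "m \<in> monomials_of_degree {insert v F} s" for m
  proof -
    have k: "Poly_Mapping.keys m = insert v F" and deg: "(\<Sum>u\<in>insert v F. Poly_Mapping.lookup m u) = s"
      using that by (auto simp: monomials_of_degree_def)
    have ku: "Poly_Mapping.keys (Poly_Mapping.update v 0 m) = F" using k F(2) by (auto simp: keys_update)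
    have sum: "(\<Sum>u\<in>F. Poly_Mapping.lookup (Poly_Mapping.update v 0 m) u) = (\<Sum>u\<in>F. Poly_Mapping.lookup m u)"
      by (rule sum.cong) (use F(2) in \<open>auto simp: lookup_update\<close>)
    have s: "Poly_Mapping.lookup m v + (\<Sum>u\<in>F. Poly_Mapping.lookup m u) = s"
      using deg F by simp
    have pos: "0 < Poly_Mapping.lookup m v"
      using k F' by (metis insertI1 in_keys_iff gr0I)
    have "?f (?g m) = m"
      by (rule poly_mapping_eqI)
        (use s in \<open>auto simp: lookup_update lookup_add lookup_single when_def\<close>)
    moreover have "?g m \<in> ?S"
      using ku sum s pos by (simp add: monomials_of_degree_def)
    ultimately show ?thesis by blast
  qed
  have "bij_betw ?f ?S (monomials_of_degree {insert v F} s)"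
  proof (rule bij_betw_byWitness[where f' = ?g])
    show "\<forall>a\<in>?S. ?g (?f a) = a" using 1 by blast
    show "\<forall>a\<in>monomials_of_degree {insert v F} s. ?f (?g a) = a" using 2 by blast
    show "?f ` ?S \<subseteq> monomials_of_degree {insert v F} s" using 1 by blast
    show "?g ` monomials_of_degree {insert v F} s \<subseteq> ?S" using 2 by blast
  qed
  then have "card (monomials_of_degree {insert v F} s) = card ?S"
    by (rule bij_betw_same_card[symmetric])
  also have "\<dots> = (\<Sum>i<s. card (monomials_of_degree {F} i))"
    by (rule card_SigmaI) (use finite_monomials_of_degree[of F "{F}"] F in auto)
  finally show ?thesis .
qed

text \<open>
  Every variable in \<open>F\<close> occurs with a positive exponent and contributes the factor
  \<open>t + t\<^sup>2 + \<dots> = t/(1-t)\<close>.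
\<close>

lemma face_generating_function:
  assumes "finite F"
  shows "Abs_fps (\<lambda>s. of_nat (card (monomials_of_degree {F} s)) :: rat) * (1 - fps_X) ^ card F =
    fps_X ^ card F"
  using assms
proof (induction F rule: finite_induct)
  case empty
  have "monomials_of_degree {{}} s = (if s = 0 then {0 :: 'a \<Rightarrow>\<^sub>0 nat} else {})" for s
  proof -
    have "Poly_Mapping.keys m = {} \<longleftrightarrow> m = 0" for m :: "'a \<Rightarrow>\<^sub>0 nat"
      using poly_mapping_eq_sum_single[of m] by auto
    then show ?thesis by (auto simp: monomials_of_degree_def)
  qed
  then show ?case by (auto intro!: fps_ext)
next
  case (insert v F)
  let ?g = "\<lambda>F. Abs_fps (\<lambda>s. of_nat (card (monomials_of_degree {F} s)) :: rat)"
  let ?q = "Abs_fps (\<lambda>n. if n = 0 then 0 else 1 :: rat)"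
  have g: "?g (insert v F) = ?g F * ?q"
  proof (rule fps_ext)
    fix s
    have "fps_nth (?g F * ?q) s =
        (\<Sum>i=0..s. of_nat (card (monomials_of_degree {F} i)) * (if s - i = 0 then 0 else 1))"
      by (simp add: fps_mult_nth)
    also have "\<dots> = (\<Sum>i<s. of_nat (card (monomials_of_degree {F} i)))"
      by (rule sum.mono_neutral_cong_right) auto
    also have "\<dots> = fps_nth (?g (insert v F)) s"
      using card_monomials_insert[OF insert.hyps] by simp
    finally show "fps_nth (?g (insert v F)) s = fps_nth (?g F * ?q) s" ..
  qed
  have q: "?q * (1 - fps_X) = fps_X"
    by (rule fps_ext) (auto simp: right_diff_distrib)
  have "?g (insert v F) * (1 - fps_X) ^ card (insert v F) =
      (?g F * (1 - fps_X) ^ card F) * (?q * (1 - fps_X))"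
    unfolding g card_insert_disjoint[OF insert.hyps] power_Suc by (simp only: mult_ac)
  also have "\<dots> = fps_X ^ card (insert v F)"
    unfolding insert.IH q card_insert_disjoint[OF insert.hyps] power_Suc by (rule mult.commute)
  finally show ?case .
qed

lemma hilbert_series_edge_ideal:
  assumes G: "finite_graph V E" and L: "loopless E"
    and d: "\<And>F. F \<in> independence_complex V E \<Longrightarrow> card F \<le> d"
  shows "hilbert_series V (edge_ideal V E :: ('v, 'k::field) mpoly set) * (1 - fps_X) ^ d =
    (\<Sum>F\<in>independence_complex V E. fps_X ^ card F * (1 - fps_X) ^ (d - card F))"
proof -
  let ?\<Delta> = "independence_complex V E"
  let ?g = "\<lambda>F. Abs_fps (\<lambda>s. of_nat (card (monomials_of_degree {F} s)) :: rat)"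
  have V: "finite V" using G by (simp add: finite_graph_def)
  have sub: "?\<Delta> \<subseteq> Pow V" by (auto simp: independence_complex_def)
  then have fin: "finite ?\<Delta>" using V finite_subset by blast
  have "card (monomials_of_degree ?\<Delta> s) = (\<Sum>F\<in>?\<Delta>. card (monomials_of_degree {F} s))" for s
  proof -
    have "monomials_of_degree ?\<Delta> s = (\<Union>F\<in>?\<Delta>. monomials_of_degree {F} s)"
      by (auto simp: monomials_of_degree_def)
    then show ?thesis
    proof (simp only:, intro card_UN_disjoint ballI impI)
      show "finite (monomials_of_degree {F} s)" if "F \<in> ?\<Delta>" for F
        using finite_monomials_of_degree[OF V, of "{F}"] that sub by blast
      show "monomials_of_degree {F} s \<inter> monomials_of_degree {F'} s = {}" if "F \<noteq> F'" for F F'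
        using that by (auto simp: monomials_of_degree_def)
    qed (rule fin)
  qed
  then have "hilbert_series V (edge_ideal V E :: ('v, 'k) mpoly set) = (\<Sum>F\<in>?\<Delta>. ?g F)"
    by (intro fps_ext)
      (simp add: hilbert_series_def hilbert_function_edge_ideal[OF G L] fps_sum_nth)
  then have "hilbert_series V (edge_ideal V E :: ('v, 'k) mpoly set) * (1 - fps_X) ^ d =
      (\<Sum>F\<in>?\<Delta>. ?g F * (1 - fps_X) ^ d)"
    by (simp add: sum_distrib_right)
  also have "\<dots> = (\<Sum>F\<in>?\<Delta>. fps_X ^ card F * (1 - fps_X) ^ (d - card F))"
  proof (rule sum.cong[OF refl])
    fix F assume F: "F \<in> ?\<Delta>"
    then have "finite F" using sub V finite_subset by blast
    have "(1 - fps_X :: rat fps) ^ d = (1 - fps_X) ^ card F * (1 - fps_X) ^ (d - card F)"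
      using d[OF F] by (simp flip: power_add)
    then show "?g F * (1 - fps_X) ^ d = fps_X ^ card F * (1 - fps_X) ^ (d - card F)"
      using face_generating_function[OF \<open>finite F\<close>] by (simp add: mult.assoc[symmetric])
  qed
  finally show ?thesis .
qed

section \<open>The \<open>h\<close>-vector\<close>

theorem corollary7p4:
  fixes V :: "'v set" and E :: "'v set set"
    and x y :: "nat \<Rightarrow> 'v" and d :: nat
  assumes "finite_graph V E" and "loopless E"
    and "cohen_macaulay (edge_ring V E :: ('v, 'k::field) mpoly set ring)"
    and "perfect_matching V E ((\<lambda>i. {x i, y i}) ` {1..d})"
    and "inj_on (\<lambda>i. {x i, y i}) {1..d}"
    and "\<And>i. i \<in> {1..d} \<Longrightarrow> regular_edge TYPE('k) V E (x i) (y i)"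
    and "\<And>i. i \<in> {2..d} \<Longrightarrow>
           neighbors E (x i) \<inter> (x ` {1..<i} \<union> y ` {1..<i}) = {} \<or>
           neighbors E (y i) \<inter> (x ` {1..<i} \<union> y ` {1..<i}) = {}"
  shows "is_h_vector V (edge_ideal V E :: ('v, 'k) mpoly set)
    (\<lambda>i. int (f_vector
       (independence_complex (x ` {1..d})
          (induced_edges
             (whisker_edges_list E (map (\<lambda>i. (x i, y i)) [1..<Suc d])) (x ` {1..d})))
       (int i - 1)))"
proof -
  note G = assms(1) and L = assms(2) and reg = assms(6)
  let ?\<Delta> = "independence_complex V E"
  define W where "W = whisker_edges_list E (map (\<lambda>i. (x i, y i)) [1..<Suc d])"
  let ?B = "x ` {1..d}"
  let ?\<Delta>W = "independence_complex ?B (induced_edges W ?B)"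
  let ?I = "edge_ideal V E :: ('v, 'k) mpoly set"
  have finV: "finite V" using G by (simp add: finite_graph_def)
  have e: "{x i, y i} \<in> E" if "i \<in> {1..d}" for i
    using reg[OF that] by (simp add: regular_edge_def)
  have xy: "x i \<noteq> y i" if "i \<in> {1..d}" for i
    using e[OF that] L by (auto simp: loopless_def)
  have disj: "{x i, y i} \<inter> {x j, y j} = {}" if ij: "i \<in> {1..d}" "j \<in> {1..d}" "i \<noteq> j" for i j
  proof -
    have "{x i, y i} \<noteq> {x j, y j}" using inj_onD[OF assms(5)] ij by blast
    moreover have "pairwise disjnt ((\<lambda>i. {x i, y i}) ` {1..d})"
      using assms(4) by (simp add: perfect_matching_def)
    ultimately have "disjnt {x i, y i} {x j, y j}"
      using imageI[OF ij(1), of "\<lambda>i. {x i, y i}"] imageI[OF ij(2), of "\<lambda>i. {x i, y i}"]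
      by (metis (no_types, lifting) pairwiseD)
    then show ?thesis by (simp only: disjnt_def)
  qed
  have V: "V = ?B \<union> y ` {1..d}"
  proof -
    have "V = (\<Union>i\<in>{1..d}. {x i, y i})" using assms(4) by (simp add: perfect_matching_def)
    then show ?thesis by blast
  qed
  have injx: "inj_on x {1..d}"
  proof (rule inj_onI)
    fix i j assume "i \<in> {1..d}" "j \<in> {1..d}" "x i = x j"
    then show "i = j" using disj[of i j] by blast
  qed
  have injy: "inj_on y {1..d}"
  proof (rule inj_onI)
    fix i j assume "i \<in> {1..d}" "j \<in> {1..d}" "y i = y j"
    then show "i = j" using disj[of i j] by blast
  qed
  have By: "?B \<inter> y ` {1..d} = {}"
  proof -
    have "x i \<noteq> y j" if "i \<in> {1..d}" "j \<in> {1..d}" for i j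
      using that xy[of i] disj[of i j] by (cases "i = j") auto
    then show ?thesis by blast
  qed
  have faces: "F \<subseteq> V \<and> (\<forall>a\<in>F. \<forall>b\<in>F. {a, b} \<notin> E)" if "F \<in> ?\<Delta>" for F
    using that unfolding in_independence_complex_iff[OF G] .
  \<comment> \<open>The matching edge that contains \<open>v\<close>. A face contains at most one end of each edge, so \<open>index\<close>
      is injective on it; a maximal face contains an end of each edge, so \<open>index\<close> maps it onto \<open>{1..d}\<close>.\<close>
  define index where "index v = (SOME i. i \<in> {1..d} \<and> (v = x i \<or> v = y i))" for v
  have index: "index v \<in> {1..d} \<and> (v = x (index v) \<or> v = y (index v))" if "v \<in> V" for v
  proof -
    have "\<exists>i. i \<in> {1..d} \<and> (v = x i \<or> v = y i)" using that unfolding V by blast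
    then show ?thesis unfolding index_def by (rule someI_ex)
  qed
  have card_face: "card F \<le> d" if F: "F \<in> ?\<Delta>" for F
  proof -
    have "inj_on index F"
    proof (rule inj_onI)
      fix u v assume uv: "u \<in> F" "v \<in> F" "index u = index v"
      then have "u \<in> V" "v \<in> V" using faces[OF F] by blast+
      moreover have "{u, v} \<notin> E" using uv faces[OF F] by blast
      ultimately show "u = v"
        using index[of u] index[of v] uv(3) e[of "index u"] by (auto simp: insert_commute)
    qed
    moreover have "index ` F \<subseteq> {1..d}" using faces[OF F] index by blast
    ultimately have "card F \<le> card {1..d}" by (rule card_inj_on_le) simp
    then show ?thesis by simp
  qed
  have "{} \<in> ?\<Delta>" using G by (simp add: in_independence_complex_iff)
  from ex_maximal_face[OF finV this] obtain M where M: "M \<in> ?\<Delta>"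
    and max: "\<And>c. c \<in> V - M \<Longrightarrow> insert c M \<notin> ?\<Delta>" by blast
  have "d \<le> card M"
  proof -
    have "{1..d} \<subseteq> index ` M"
    proof
      fix i assume i: "i \<in> {1..d}"
      have "x i \<in> M \<or> y i \<in> M" by (rule regular_edge_meets_maximal_face[OF G L reg[OF i] M max])
      then obtain v where v: "v \<in> M" "v = x i \<or> v = y i" by blast
      then have "v \<in> V" using faces[OF M] by blast
      note idx = index[OF this]
      have "index v = i"
      proof (rule ccontr)
        assume "index v \<noteq> i"
        then have "{x i, y i} \<inter> {x (index v), y (index v)} = {}"
          using disj[OF i conjunct1[OF idx]] by simp
        moreover have "v \<in> {x i, y i}" using v(2) by simp
        moreover have "v \<in> {x (index v), y (index v)}" using conjunct2[OF idx] by simp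
        ultimately show False by blast
      qed
      then show "i \<in> index ` M" using v(1) by blast
    qed
    moreover have "finite M" using faces[OF M] finV finite_subset by blast
    ultimately have "card {1..d} \<le> card M" by (meson card_image_le card_mono finite_imageI le_trans)
    then show ?thesis by simp
  qed
  then have "enat d \<le> krull_dim (poly_ring V Quot ?I)"
    using krull_dim_quotient_ge[OF G L M, where ?'k = 'k] by (meson enat_ord_simps(1) order_trans)
  then have dim: "krull_dim (poly_ring V Quot ?I) = enat d"
    using krull_dim_quotient_le[OF G L card_face, where ?'k = 'k] by (meson order_antisym)
  have regE: "{a, b} \<in> E" if "i \<in> {1..d}" "{a, x i} \<in> E" "{b, y i} \<in> E" for i a b
    using regular_edge_neighbors_adjacent[OF G L reg[OF that(1)] that(2,3)] .
  have whiskered: "whiskered_along V E x y d W"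
    unfolding W_def by (rule whisker_along_matching[OF G L e disj regE assms(7) order_refl])
  then have H: "finite_graph V W"
    unfolding whiskered_along_def by (rule conjunct1)
  from whiskered have fH: "f_vector (independence_complex V W) = f_vector ?\<Delta>"
    unfolding whiskered_along_def by (rule conjunct1[OF conjunct2[OF conjunct2]])
  from whiskered have leaves: "\<forall>u. \<forall>i\<in>{1..d}. {u, y i} \<in> W \<longleftrightarrow> u = x i"
    unfolding whiskered_along_def
    by (rule conjunct2[OF conjunct2[OF conjunct2[OF conjunct2[OF conjunct2]]]])
  have whisker: "{u, y i} \<in> W \<longleftrightarrow> u = x i" if i: "i \<in> {1..d}" for i u
    using bspec[OF spec[OF leaves] i] .
  have fin: "finite ?\<Delta>" "finite (independence_complex V W)" "finite ?\<Delta>W"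
    using finite_subset[of _ "Pow V"] finite_subset[of _ "Pow ?B"] finV
    by (auto simp: independence_complex_def)
  have card_faceB: "card S \<le> d" if "S \<in> ?\<Delta>W" for S
  proof -
    have "S \<subseteq> ?B" using that by (simp add: independence_complex_def)
    then have "card S \<le> card ?B" by (rule card_mono[rotated]) simp
    also have "\<dots> \<le> d" using card_image_le[of "{1..d}" x] by simp
    finally show ?thesis .
  qed
  \<comment> \<open>The bound for the faces carries over from \<open>E\<close> to \<open>W\<close> by the equality of the \<open>f\<close>-vectors.\<close>
  have card_faceH: "card F \<le> d" if F: "F \<in> independence_complex V W" for F
  proof -
    have "0 < f_vector (independence_complex V W) (int (card F) - 1)"
      unfolding f_vector_def using F fin(2) by (subst card_gt_0_iff) auto
    then have "0 < f_vector ?\<Delta> (int (card F) - 1)" by (simp only: fH)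
    then obtain F' where "F' \<in> ?\<Delta>" "card F' = card F"
      unfolding f_vector_def by (subst (asm) card_gt_0_iff) auto
    then show ?thesis using card_face by metis
  qed
  let ?g = "\<lambda>n. fps_X ^ n * (1 - fps_X) ^ (d - n) :: rat fps"
  have "hilbert_series V ?I * (1 - fps_X) ^ d = (\<Sum>F\<in>?\<Delta>. ?g (card F))"
    by (rule hilbert_series_edge_ideal[OF G L card_face])
  also have "\<dots> = (\<Sum>i\<le>d. of_nat (f_vector ?\<Delta> (int i - 1)) * ?g i)"
    by (rule sum_over_faces_f_vector[OF fin(1) card_face])
  also have "\<dots> = (\<Sum>F\<in>independence_complex V W. ?g (card F))"
    unfolding fH[symmetric] by (rule sum_over_faces_f_vector[OF fin(2) card_faceH, symmetric])
  also have "\<dots> = (\<Sum>S\<in>?\<Delta>W. fps_X ^ card S)"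
    by (rule whiskered_face_sum[OF H V injx injy By whisker])
  also have "\<dots> = (\<Sum>i\<le>d. of_nat (f_vector ?\<Delta>W (int i - 1)) * fps_X ^ i)"
    by (rule sum_over_faces_f_vector[OF fin(3) card_faceB])
  also have "\<dots> = (\<Sum>i\<le>d. fps_const (of_int (int (f_vector ?\<Delta>W (int i - 1)))) * fps_X ^ i)"
    by (simp add: fps_of_nat)
  finally have series: "hilbert_series V ?I * (1 - fps_X) ^ d =
    (\<Sum>i\<le>d. fps_const (of_int (int (f_vector ?\<Delta>W (int i - 1)))) * fps_X ^ i)" .
  have "(1 - fps_X :: rat fps) \<noteq> 0"
  proof
    assume "(1 - fps_X :: rat fps) = 0"
    then have "fps_nth (1 - fps_X :: rat fps) 0 = 0" by simp
    then show False by simp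
  qed
  then have "hilbert_series V ?I =
    (\<Sum>i\<le>d. fps_const (of_int (int (f_vector ?\<Delta>W (int i - 1)))) * fps_X ^ i) / (1 - fps_X) ^ d"
    unfolding series[symmetric] by simp
  moreover have "int (f_vector ?\<Delta>W (int i - 1)) = 0" if "d < i" for i
  proof -
    have "{S \<in> ?\<Delta>W. int (card S) = int i - 1 + 1} = {}" using card_faceB that by fastforce
    then show ?thesis unfolding f_vector_def by (simp only: card.empty of_nat_0)
  qed
  ultimately show ?thesis unfolding is_h_vector_def W_def[symmetric] using dim by blast
qed

end
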